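(* Let $2\alpha+\gamma>1$. Then, as $n\to\infty$, $$\|\mu_n^{-1/2}A^{1/2}\phi_n^{(1)}\|^2=O\big(n^{-(2\alpha+\gamma)}\sigma_{2\alpha,\gamma}(n)\big)+O\big(n^{-2\alpha}\tau_{2\alpha,\gamma}(n)\big),$$ and for every $k=2,3,\dots$, as $n\to\infty$, $$\|\mu_n^{-1/2}A^{1/2}\phi_n^{(k)}\|^2=O\Big(\sigma_{2\alpha,\gamma}(n)^{2(k-1)}\big(n^{-(2\alpha+\gamma)}\sigma_{2\alpha,\gamma}(n)+n^{-2\alpha}\tau_{2\alpha,\gamma}(n)\big)\Big).$$
   Context: $H$ is a separable infinite-dimensional complex Hilbert space with inner product $(\cdot,\cdot)$ and norm $\|\cdot\|$. $a$ is a closed, densely defined, Hermitian, positive-definite sesquilinear form with domain $V\subset H$, and $A$ is the associated self-adjoint operator: $V=D(A^{1/2})$, $a(u,v)=(A^{1/2}u,A^{1/2}v)$. $A$ has compact resolvent, with eigenvalues $0<\mu_1\le\mu_2\le\dots$ (with multiplicity) and an orthonormal basis of eigenvectors $\psi_k$ of $H$. $b$ is a sesquilinear form on $V$ (continuous in the $V$-norm, hence determined by the values $b(\psi_m,\psi_n)$). Standing assumptions: there are $\gamma>0$, $\kappa>0$, $N_0>0$ with $\mu_{k+1}-\mu_k\ge\kappa k^{\gamma-1}$ for all $k\ge N_0$; and there are $\alpha\in\mathbb R$ with $2\alpha+\gamma>1$ and $M_b>0$ with $|b(\psi_m,\psi_n)|\le M_bm^{-\alpha}n^{-\alpha}$ for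 all $m,n\in\mathbb N$. For $z\in\rho(A)$: $K(z)u=\sum_k(z-\mu_k)^{-1/2}(u,\psi_k)\psi_k$ (with $w^s=|w|^se^{is\arg w}$, $\arg w\in(-\pi,\pi]$), and $B(z)$ is the bounded operator on $H$ determined by $(B(z)u,v)=b(K(z)u,K^\ast(z)v)$ for $u,v\in H$. For $n$ large let $\Gamma_n=\partial\Pi_n$, positively oriented, $\Pi_n=\{z\in\mathbb C:\mu_n-\frac\kappa2(n-1)^{\gamma-1}<\operatorname{Re}z<\mu_n+\frac\kappa2n^{\gamma-1},\ |\operatorname{Im}z|<\frac\kappa2n^{\gamma-1}\}$ (a contour around the single eigenvalue $\mu_n$ of $A$), and $$\phi_n^{(k)}=\frac1{2\pi i}\int_{\Gamma_n}K(z)B^k(z)K(z)\psi_n\,dz,\quad k=1,2,\dots$$ $\sigma_{\omega,\gamma}(n)=n^{-\omega-\gamma+1}\ln(en)$ if $\omega\le1$ and $n^{-\gamma}$ if $\omega>1$; $\tau_{\omega,\gamma}(n)=n^{-(\omega+2\gamma-2)}$ if $\omega\le2$ and $n^{-2\gamma}$ if $\omega>2$. *)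

theory Defs
  imports "HOL-Analysis.Analysis" "HOL-Library.Landau_Symbols"
begin

section \<open>Complex Hilbert spaces\<close>

text \<open>
  The inner product is linear in the first and conjugate-linear in the second argument. The real
  structure underlying the complex one is that of the class \<open>real_inner\<close>, so norm, limits, infinite
  sums and integrals are those of the library.
\<close>

class complex_inner = real_inner +
  fixes scaleC :: "complex \<Rightarrow> 'a \<Rightarrow> 'a"  (infixr "*\<^sub>C" 75)
    and cinner :: "'a \<Rightarrow> 'a \<Rightarrow> complex"
  assumes scaleC_add_right: "c *\<^sub>C (x + y) = c *\<^sub>C x + c *\<^sub>C y"
    and scaleC_add_left: "(c + d) *\<^sub>C x = c *\<^sub>C x + d *\<^sub>C x"
    and scaleC_scaleC: "c *\<^sub>C d *\<^sub>C x = (c * d) *\<^sub>C x"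
    and scaleC_complex_of_real: "complex_of_real r *\<^sub>C x = r *\<^sub>R x"
    and cinner_commute: "cinner x y = cnj (cinner y x)"
    and cinner_add_left: "cinner (x + y) z = cinner x z + cinner y z"
    and cinner_scaleC_left: "cinner (c *\<^sub>C x) y = c * cinner x y"
    and Re_cinner: "Re (cinner x y) = inner x y"

class chilbert_space = complex_inner + banach

text \<open>Having no finite spanning set is the same condition over the reals and over the complex
  numbers, so the library's real span is used.\<close>

definition infinite_dimensional :: "'h::real_vector itself \<Rightarrow> bool" where
  "infinite_dimensional _ \<longleftrightarrow> \<not> (\<exists>F::'h set. finite F \<and> span F = UNIV)"

definition csubspace :: "'h::complex_inner set \<Rightarrow> bool" where
  "csubspace V \<longleftrightarrow> 0 \<in> V \<and> (\<forall>x\<in>V. \<forall>y\<in>V. x + y \<in> V) \<and> (\<forall>c. \<forall>x\<in>V. c *\<^sub>C x \<in> V)"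

definition bounded_clinear :: "('h::complex_inner \<Rightarrow> 'h) \<Rightarrow> bool" where
  "bounded_clinear T \<longleftrightarrow> bounded_linear T \<and> (\<forall>c x. T (c *\<^sub>C x) = c *\<^sub>C T x)"

text \<open>Meaningful for bounded operators on a Hilbert space, where the adjoint exists and is unique.\<close>

definition cadjoint :: "('h::complex_inner \<Rightarrow> 'h) \<Rightarrow> 'h \<Rightarrow> 'h" where
  "cadjoint T = (SOME T'. \<forall>u v. cinner (T u) v = cinner u (T' v))"

definition orthonormal_basis :: "'i set \<Rightarrow> ('i \<Rightarrow> 'h::complex_inner) \<Rightarrow> bool" where
  "orthonormal_basis I \<psi> \<longleftrightarrow>
     (\<forall>j\<in>I. \<forall>k\<in>I. cinner (\<psi> j) (\<psi> k) = (if j = k then 1 else 0)) \<and>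
     (\<forall>u. ((\<lambda>k. cinner u (\<psi> k) *\<^sub>C \<psi> k) has_sum u) I)"


section \<open>Sesquilinear forms\<close>

text \<open>A form with domain \<open>V\<close> is a function on the whole space whose values outside \<open>V\<close> are
  irrelevant.\<close>

definition sesquilinear_on :: "'h::complex_inner set \<Rightarrow> ('h \<Rightarrow> 'h \<Rightarrow> complex) \<Rightarrow> bool" where
  "sesquilinear_on V a \<longleftrightarrow> csubspace V \<and>
     (\<forall>x\<in>V. \<forall>y\<in>V. \<forall>z\<in>V. a (x + y) z = a x z + a y z \<and> a z (x + y) = a z x + a z y) \<and>
     (\<forall>c. \<forall>x\<in>V. \<forall>y\<in>V. a (c *\<^sub>C x) y = c * a x y \<and> a x (c *\<^sub>C y) = cnj c * a x y)"

definition hermitian_on :: "'h set \<Rightarrow> ('h \<Rightarrow> 'h \<Rightarrow> complex) \<Rightarrow> bool" where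
  "hermitian_on V a \<longleftrightarrow> (\<forall>x\<in>V. \<forall>y\<in>V. a x y = cnj (a y x))"

definition positive_definite_on :: "'h::zero set \<Rightarrow> ('h \<Rightarrow> 'h \<Rightarrow> complex) \<Rightarrow> bool" where
  "positive_definite_on V a \<longleftrightarrow> (\<forall>x\<in>V. x \<noteq> 0 \<longrightarrow> Re (a x x) > 0)"

definition closed_form :: "'h::real_normed_vector set \<Rightarrow> ('h \<Rightarrow> 'h \<Rightarrow> complex) \<Rightarrow> bool" where
  "closed_form V a \<longleftrightarrow>
     (\<forall>u x. (\<forall>n::nat. u n \<in> V) \<longrightarrow> u \<longlonglongrightarrow> x \<longrightarrow>
        (\<forall>e>0. \<exists>N. \<forall>m\<ge>N. \<forall>n\<ge>N. Re (a (u m - u n) (u m - u n)) < e) \<longrightarrow>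
        x \<in> V \<and> (\<lambda>n. Re (a (u n - x) (u n - x))) \<longlonglongrightarrow> 0)"

definition form_norm :: "('h::real_normed_vector \<Rightarrow> 'h \<Rightarrow> complex) \<Rightarrow> 'h \<Rightarrow> real" where
  "form_norm a u = sqrt ((norm u)\<^sup>2 + Re (a u u))"

definition form_continuous_on ::
  "'h::real_normed_vector set \<Rightarrow> ('h \<Rightarrow> 'h \<Rightarrow> complex) \<Rightarrow> ('h \<Rightarrow> 'h \<Rightarrow> complex) \<Rightarrow> bool" where
  "form_continuous_on V a b \<longleftrightarrow>
     (\<exists>C. \<forall>u\<in>V. \<forall>v\<in>V. norm (b u v) \<le> C * form_norm a u * form_norm a v)"


section \<open>Unbounded operators\<close>

text \<open>An operator is given by its domain \<open>D\<close> and a function \<open>A\<close> whose values outside \<open>D\<close> are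
  irrelevant.\<close>

definition densely_defined_operator :: "'h::complex_inner set \<Rightarrow> ('h \<Rightarrow> 'h) \<Rightarrow> bool" where
  "densely_defined_operator D A \<longleftrightarrow> csubspace D \<and> closure D = UNIV \<and>
     (\<forall>x\<in>D. \<forall>y\<in>D. A (x + y) = A x + A y) \<and> (\<forall>c. \<forall>x\<in>D. A (c *\<^sub>C x) = c *\<^sub>C A x)"

definition adjoint_graph :: "'h::complex_inner set \<Rightarrow> ('h \<Rightarrow> 'h) \<Rightarrow> ('h \<times> 'h) set" where
  "adjoint_graph D A = {(v, w). \<forall>u\<in>D. cinner (A u) v = cinner u w}"

definition self_adjoint :: "'h::complex_inner set \<Rightarrow> ('h \<Rightarrow> 'h) \<Rightarrow> bool" where
  "self_adjoint D A \<longleftrightarrow> densely_defined_operator D A \<and> adjoint_graph D A = {(v, A v) | v. v \<in> D}"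

text \<open>\<open>S\<close> with domain \<open>E\<close> is the non-negative self-adjoint square root of \<open>A\<close> with domain \<open>D\<close>; on its
  domain it is uniquely determined by \<open>A\<close>.\<close>

definition nonneg_square_root ::
  "'h::complex_inner set \<Rightarrow> ('h \<Rightarrow> 'h) \<Rightarrow> 'h set \<Rightarrow> ('h \<Rightarrow> 'h) \<Rightarrow> bool" where
  "nonneg_square_root D A E S \<longleftrightarrow> self_adjoint E S \<and> (\<forall>u\<in>E. Re (cinner (S u) u) \<ge> 0) \<and>
     D = {u \<in> E. S u \<in> E} \<and> (\<forall>u\<in>D. A u = S (S u))"

definition resolvent_set :: "'h::complex_inner set \<Rightarrow> ('h \<Rightarrow> 'h) \<Rightarrow> complex set" where
  "resolvent_set D A = {z. bij_betw (\<lambda>u. z *\<^sub>C u - A u) D UNIV \<and>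
     (\<exists>C. \<forall>u\<in>D. norm u \<le> C * norm (z *\<^sub>C u - A u))}"

definition resolvent :: "'h::complex_inner set \<Rightarrow> ('h \<Rightarrow> 'h) \<Rightarrow> complex \<Rightarrow> 'h \<Rightarrow> 'h" where
  "resolvent D A z = inv_into D (\<lambda>u. z *\<^sub>C u - A u)"

definition compact_resolvent :: "'h::complex_inner set \<Rightarrow> ('h \<Rightarrow> 'h) \<Rightarrow> bool" where
  "compact_resolvent D A \<longleftrightarrow>
     (\<exists>z\<in>resolvent_set D A. compact (closure (resolvent D A z ` cball 0 1)))"


section \<open>The operators \<open>K(z)\<close> and \<open>B(z)\<close> and the contour integrals\<close>

text \<open>Eigenvalues \<open>\<mu> k\<close> and eigenvectors \<open>\<psi> k\<close> are indexed by \<open>k \<ge> 1\<close>. The function powr uses the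
  principal argument in \<open>(-pi, pi]\<close>.\<close>

definition K_op :: "(nat \<Rightarrow> real) \<Rightarrow> (nat \<Rightarrow> 'h::chilbert_space) \<Rightarrow> complex \<Rightarrow> 'h \<Rightarrow> 'h" where
  "K_op \<mu> \<psi> z u =
     (\<Sum>\<^sub>\<infinity>k\<in>{1..}. ((z - of_real (\<mu> k)) powr (-1/2)) *\<^sub>C (cinner u (\<psi> k) *\<^sub>C \<psi> k))"

definition B_op ::
  "(nat \<Rightarrow> real) \<Rightarrow> (nat \<Rightarrow> 'h::chilbert_space) \<Rightarrow> ('h \<Rightarrow> 'h \<Rightarrow> complex) \<Rightarrow> complex \<Rightarrow> 'h \<Rightarrow> 'h" where
  "B_op \<mu> \<psi> b z = (THE T. bounded_clinear T \<and>
     (\<forall>u v. cinner (T u) v = b (K_op \<mu> \<psi> z u) (cadjoint (K_op \<mu> \<psi> z) v)))"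

text \<open>The Hilbert-space-valued analogue of the library's contour integral.\<close>

definition vector_contour_integral ::
  "(real \<Rightarrow> complex) \<Rightarrow> (complex \<Rightarrow> 'h::chilbert_space) \<Rightarrow> 'h" where
  "vector_contour_integral g f =
     integral {0..1} (\<lambda>t. vector_derivative g (at t within {0..1}) *\<^sub>C f (g t))"

text \<open>The boundary of the rectangle with vertical sides at
  \<open>\<mu>\<^sub>n - (\<kappa>/2) (n-1)\<^bsup>\<gamma>-1\<^esup>\<close> and \<open>\<mu>\<^sub>n + (\<kappa>/2) n\<^bsup>\<gamma>-1\<^esup>\<close> and horizontal sides at \<open>\<plusminus>(\<kappa>/2) n\<^bsup>\<gamma>-1\<^esup>\<close>; rectpath
  takes the lower left and the upper right corner and runs counterclockwise.\<close>

definition \<Gamma>_path :: "(nat \<Rightarrow> real) \<Rightarrow> real \<Rightarrow> real \<Rightarrow> nat \<Rightarrow> real \<Rightarrow> complex" where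
  "\<Gamma>_path \<mu> \<kappa> \<gamma> n = rectpath
     (Complex (\<mu> n - \<kappa> / 2 * (real n - 1) powr (\<gamma> - 1)) (- (\<kappa> / 2 * real n powr (\<gamma> - 1))))
     (Complex (\<mu> n + \<kappa> / 2 * real n powr (\<gamma> - 1)) (\<kappa> / 2 * real n powr (\<gamma> - 1)))"

definition \<phi>_vec ::
  "(nat \<Rightarrow> real) \<Rightarrow> (nat \<Rightarrow> 'h::chilbert_space) \<Rightarrow> ('h \<Rightarrow> 'h \<Rightarrow> complex) \<Rightarrow> real \<Rightarrow> real \<Rightarrow>
    nat \<Rightarrow> nat \<Rightarrow> 'h" where
  "\<phi>_vec \<mu> \<psi> b \<kappa> \<gamma> k n = (1 / (2 * of_real pi * \<i>)) *\<^sub>C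
     vector_contour_integral (\<Gamma>_path \<mu> \<kappa> \<gamma> n)
       (\<lambda>z. K_op \<mu> \<psi> z ((B_op \<mu> \<psi> b z ^^ k) (K_op \<mu> \<psi> z (\<psi> n))))"

definition \<sigma>_rate :: "real \<Rightarrow> real \<Rightarrow> nat \<Rightarrow> real" where
  "\<sigma>_rate \<omega> \<gamma> n =
     (if \<omega> \<le> 1 then real n powr (- \<omega> - \<gamma> + 1) * ln (exp 1 * real n) else real n powr (- \<gamma>))"

definition \<tau>_rate :: "real \<Rightarrow> real \<Rightarrow> nat \<Rightarrow> real" where
  "\<tau>_rate \<omega> \<gamma> n =
     (if \<omega> \<le> 2 then real n powr (- (\<omega> + 2 * \<gamma> - 2)) else real n powr (- 2 * \<gamma>))"

end

theory Submission
  imports Defs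
begin

text \<open>
  Put \<open>w\<^sub>m(z) = |z - \<mu>\<^sub>m|\<close>. In the basis \<open>\<psi>\<close> the matrix of \<open>B(z)\<close> is dominated by the rank-one
  matrix \<open>M p\<^sub>m p\<^sub>j\<close> with \<open>p\<^sub>m = m\<^bsup>-\<alpha>\<^esup> w\<^sub>m\<^bsup>-1/2\<^esup>\<close>. Powers of a rank-one matrix are explicit, so the
  \<open>m\<close>-th coefficient of \<open>K B\<^sup>k K \<psi>\<^sub>n\<close> is at most
  \<open>M\<^sup>k P\<^bsup>k-1\<^esup> m\<^bsup>-\<alpha>\<^esup> n\<^bsup>-\<alpha>\<^esup> / (w\<^sub>m w\<^sub>n)\<close> with \<open>P = \<Sum>\<^sub>j j\<^bsup>-2\<alpha>\<^esup> / w\<^sub>j\<close>. On \<open>\<Gamma>\<^sub>n\<close> the gap condition gives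
  \<open>P = O(\<sigma>)\<close>, \<open>w\<^sub>n \<ge> c n\<^bsup>\<gamma>-1\<^esup>\<close> and \<open>w\<^sub>m \<ge> c |\<mu>\<^sub>m - \<mu>\<^sub>n|\<close>, and the length of \<open>\<Gamma>\<^sub>n\<close> is
  \<open>O(n\<^bsup>\<gamma>-1\<^esup>)\<close>. Integrating each coefficient separately and then summing
  \<open>\<mu>\<^sub>m / \<mu>\<^sub>n \<le> 1 + |\<mu>\<^sub>m - \<mu>\<^sub>n| / \<mu>\<^sub>n\<close> times the squares yields the \<open>\<tau>\<close> term from the \<open>1\<close> and
  the \<open>n\<^bsup>-\<gamma>\<^esup> \<sigma>\<close> term from the rest. No cancellation in the contour integral is used.
\<close>

section \<open>Orthonormal expansions\<close>

lemma cinner_zero_left [simp]: "cinner 0 (y::'h::complex_inner) = 0"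
  using cinner_add_left[of 0 0 y] by simp

lemma cinner_scaleC_right: "cinner x (c *\<^sub>C y :: 'h::complex_inner) = cnj c * cinner x y"
  by (metis cinner_commute cinner_scaleC_left complex_cnj_mult)

lemma cinner_scaleR_left: "cinner (r *\<^sub>R x :: 'h::complex_inner) y = of_real r * cinner x y"
  by (metis scaleC_complex_of_real cinner_scaleC_left)

lemma cinner_sum_left: "cinner (sum f F) (y :: 'h::complex_inner) = (\<Sum>j\<in>F. cinner (f j) y)"
  by (induction F rule: infinite_finite_induct) (auto simp: cinner_add_left)

lemma cinner_self: "cinner x (x :: 'h::complex_inner) = of_real ((norm x)\<^sup>2)"
proof (rule complex_eqI)
  show "Re (cinner x x) = Re (of_real ((norm x)\<^sup>2))"
    by (simp add: Re_cinner power2_norm_eq_inner)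
  have "Im (cinner x x) = - Im (cinner x x)"
    by (metis cinner_commute cnj.sel(2))
  then show "Im (cinner x x) = Im (of_real ((norm x)\<^sup>2))"
    by simp
qed

lemma norm_scaleC: "norm (c *\<^sub>C x :: 'h::complex_inner) = norm c * norm x"
proof -
  have "complex_of_real ((norm (c *\<^sub>C x))\<^sup>2) = of_real ((norm c * norm x)\<^sup>2)"
    by (simp add: cinner_self[symmetric] cinner_scaleC_left cinner_scaleC_right power_mult_distrib
        complex_norm_square mult_ac del: of_real_power)
  then have "(norm (c *\<^sub>C x))\<^sup>2 = (norm c * norm x)\<^sup>2"
    using of_real_eq_iff by blast
  then show ?thesis
    by (simp add: power2_eq_iff_nonneg)
qed

lemma cinner_Cauchy_Schwarz: "norm (cinner x (y :: 'h::complex_inner)) \<le> norm x * norm y"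
proof -
  let ?c = "cinner x y"
  have "(norm ?c)\<^sup>2 = Re (cinner (cnj ?c *\<^sub>C x) y)"
    by (simp add: cinner_scaleC_left cmod_power2) (simp add: power2_eq_square)
  also have "\<dots> \<le> norm (cnj ?c *\<^sub>C x) * norm y"
    unfolding Re_cinner by (rule norm_cauchy_schwarz)
  also have "\<dots> = norm ?c * (norm x * norm y)"
    by (simp add: norm_scaleC)
  finally have "norm ?c * norm ?c \<le> norm ?c * (norm x * norm y)"
    by (simp add: power2_eq_square)
  then show ?thesis
    by (cases "?c = 0") auto
qed

lemma bounded_linear_cinner_left: "bounded_linear (\<lambda>x. cinner x (y :: 'h::complex_inner))"
  by (rule bounded_linear_intro[where K = "norm y"])
    (auto simp: cinner_add_left cinner_scaleR_left scaleR_conv_of_real cinner_Cauchy_Schwarz)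

lemma scaleC_minus_one: "(-1) *\<^sub>C (x :: 'h::complex_inner) = - x"
  using scaleC_complex_of_real[of "-1" x] by simp

text \<open>The sets \<open>{1..N}\<close> are cofinal among the finite subsets of
  \<open>{1..}\<close>, so unordered summation yields the limit of the ordered partial sums.
  Monotone sequences and limit comparisons then become available.\<close>

lemma has_sum_imp_tendsto_from_1:
  assumes "(f has_sum x) {1::nat..}"
  shows "(\<lambda>N. \<Sum>k=1..N. f k) \<longlonglongrightarrow> x"
proof -
  have "filterlim (\<lambda>N. {1..N}) (finite_subsets_at_top {1::nat..}) sequentially"
    unfolding filterlim_finite_subsets_at_top
  proof (intro allI impI)
    fix X :: "nat set"
    assume X: "finite X \<and> X \<subseteq> {1..}"
    then obtain N where "X \<subseteq> {..N}"
      by (meson finite_nat_iff_bounded_le)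
    then show "\<forall>\<^sub>F n in sequentially. finite {1..n} \<and> X \<subseteq> {1..n} \<and> {1..n} \<subseteq> {1..}"
      using X by (intro eventually_sequentiallyI[of N]) force
  qed
  then show ?thesis
    using assms unfolding has_sum_def by (rule filterlim_compose[rotated])
qed

lemma sum_mult_le_sqrt:
  fixes x y :: "nat \<Rightarrow> real"
  assumes "(\<Sum>j\<in>F. (x j)\<^sup>2) \<le> X" "(\<Sum>j\<in>F. (y j)\<^sup>2) \<le> Y"
  shows "(\<Sum>j\<in>F. x j * y j) \<le> sqrt X * sqrt Y"
proof -
  have nn: "0 \<le> (\<Sum>j\<in>F. (x j)\<^sup>2)" "0 \<le> (\<Sum>j\<in>F. (y j)\<^sup>2)"
    by (simp_all add: sum_nonneg)
  have "(\<Sum>j\<in>F. x j * y j) \<le> sqrt (\<Sum>j\<in>F. (x j)\<^sup>2) * sqrt (\<Sum>j\<in>F. (y j)\<^sup>2)"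
    using Cauchy_Schwarz_ineq_sum[of x y F]
    by (metis real_le_rsqrt real_sqrt_mult)
  also have "\<dots> \<le> sqrt X * sqrt Y"
    using assms nn by (intro mult_mono) (auto intro: order_trans)
  finally show ?thesis .
qed

section \<open>Bessel, Riesz-Fischer and Parseval for an orthonormal basis\<close>

locale hilbert_basis =
  fixes \<psi> :: "nat \<Rightarrow> 'h::chilbert_space"
  assumes basis: "orthonormal_basis {1..} \<psi>"
begin

lemma orthonormal: "j \<ge> 1 \<Longrightarrow> k \<ge> 1 \<Longrightarrow> cinner (\<psi> j) (\<psi> k) = (if j = k then 1 else 0)"
  using basis unfolding orthonormal_basis_def by auto

lemma expansion: "((\<lambda>k. cinner u (\<psi> k) *\<^sub>C \<psi> k) has_sum u) {1..}"
  using basis unfolding orthonormal_basis_def by auto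

lemma vector_eqI:
  assumes "\<And>k. k \<ge> 1 \<Longrightarrow> cinner x (\<psi> k) = cinner y (\<psi> k)"
  shows "x = y"
proof -
  have "((\<lambda>k. cinner x (\<psi> k) *\<^sub>C \<psi> k) has_sum y) {1..}"
    using expansion[of y] assms by (subst has_sum_cong[of _ _ "\<lambda>k. cinner y (\<psi> k) *\<^sub>C \<psi> k"]) auto
  then show ?thesis
    using expansion[of x] has_sum_unique by blast
qed

lemma cinner_sum_basis:
  assumes "k \<ge> 1"
  shows "cinner (\<Sum>j=1..N. c j *\<^sub>C \<psi> j) (\<psi> k) = (if k \<le> N then c k else 0)"
proof -
  have "cinner (\<Sum>j=1..N. c j *\<^sub>C \<psi> j) (\<psi> k) = (\<Sum>j=1..N. if k = j then c j else 0)"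
    unfolding cinner_sum_left using assms
    by (intro sum.cong) (auto simp: cinner_scaleC_left orthonormal)
  then show ?thesis
    using assms by simp
qed

lemma norm_sum_basis:
  assumes "finite F" "F \<subseteq> {1..}"
  shows "(norm (\<Sum>j\<in>F. c j *\<^sub>C \<psi> j))\<^sup>2 = (\<Sum>j\<in>F. (norm (c j))\<^sup>2)"
proof -
  have "pairwise (\<lambda>i j. orthogonal (c i *\<^sub>C \<psi> i) (c j *\<^sub>C \<psi> j)) F"
  proof (rule pairwiseI)
    fix i j assume "i \<in> F" "j \<in> F" "i \<noteq> j"
    moreover from this have "i \<ge> 1" "j \<ge> 1"
      using assms by auto
    ultimately have "cinner (c i *\<^sub>C \<psi> i) (c j *\<^sub>C \<psi> j) = 0"
      by (simp add: cinner_scaleC_left cinner_scaleC_right orthonormal)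
    then show "orthogonal (c i *\<^sub>C \<psi> i) (c j *\<^sub>C \<psi> j)"
      by (simp add: orthogonal_def Re_cinner[symmetric])
  qed
  then have "(norm (\<Sum>j\<in>F. c j *\<^sub>C \<psi> j))\<^sup>2 = (\<Sum>j\<in>F. (norm (c j *\<^sub>C \<psi> j))\<^sup>2)"
    using assms by (intro norm_sum_Pythagorean) auto
  also have "\<dots> = (\<Sum>j\<in>F. (norm (c j))\<^sup>2)"
  proof (rule sum.cong)
    fix j assume "j \<in> F"
    then have "cinner (\<psi> j) (\<psi> j) = 1"
      using assms orthonormal[of j j] by auto
    then have "(norm (\<psi> j))\<^sup>2 = 1"
      using cinner_self[of "\<psi> j"] of_real_eq_1_iff by metis
    then show "(norm (c j *\<^sub>C \<psi> j))\<^sup>2 = (norm (c j))\<^sup>2"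
      by (simp add: norm_scaleC power_mult_distrib)
  qed simp
  finally show ?thesis .
qed

text \<open>The partial sums are the squared norms of the partial expansions of \<open>x\<close>, so
  they increase to \<open>(norm x)\<^sup>2\<close>.\<close>

lemma Bessel_partial: "(\<Sum>k=1..N. (norm (cinner x (\<psi> k)))\<^sup>2) \<le> (norm x)\<^sup>2"
proof -
  let ?T = "\<lambda>N. \<Sum>k=1..N. (norm (cinner x (\<psi> k)))\<^sup>2"
  have "?T = (\<lambda>N. (norm (\<Sum>k=1..N. cinner x (\<psi> k) *\<^sub>C \<psi> k))\<^sup>2)"
    by (intro ext norm_sum_basis[symmetric]) auto
  then have "?T \<longlonglongrightarrow> (norm x)\<^sup>2"
    using has_sum_imp_tendsto_from_1[OF expansion[of x]]
    by (auto intro!: tendsto_intros)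
  moreover have "incseq ?T"
    by (intro incseq_SucI) simp
  ultimately show ?thesis
    by (rule incseq_le[rotated])
qed

text \<open>The bounded increasing sequence \<open>T\<close> is Cauchy, \<open>diff\<close>
  transfers this to the partial series \<open>s\<close>, and completeness gives the vector. This is
  the tool that builds \<open>K\<close>, its adjoint and \<open>B\<close> from prescribed
  coefficients.\<close>

lemma Riesz_Fischer:
  assumes bound: "\<And>N. (\<Sum>k=1..N. (norm (c k))\<^sup>2) \<le> X"
  shows "\<exists>x. (\<forall>k\<ge>1. cinner x (\<psi> k) = c k) \<and> (norm x)\<^sup>2 \<le> X"
proof -
  define T where "T = (\<lambda>N. \<Sum>k=1..N. (norm (c k))\<^sup>2)"
  define s where "s = (\<lambda>N. \<Sum>k=1..N. c k *\<^sub>C \<psi> k)"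
  have norm_s: "(norm (s N))\<^sup>2 = T N" for N
    unfolding s_def T_def by (rule norm_sum_basis) auto
  have diff: "(norm (s n - s m))\<^sup>2 = T n - T m" if "m \<le> n" for m n
  proof -
    have split: "{1..n} = {1..m} \<union> {m<..n}"
      using that by auto
    have "s n - s m = (\<Sum>k\<in>{m<..n}. c k *\<^sub>C \<psi> k)" "T n - T m = (\<Sum>k\<in>{m<..n}. (norm (c k))\<^sup>2)"
      unfolding s_def T_def split by (subst sum.union_disjoint; force)+
    then show ?thesis
      by (simp add: norm_sum_basis subset_eq)
  qed
  have "incseq T"
    unfolding T_def by (intro incseq_SucI) simp
  moreover have "\<And>N. T N \<le> X"
    unfolding T_def by (rule bound)
  ultimately obtain L where "T \<longlonglongrightarrow> L"
    by (metis incseq_convergent)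
  then have "Cauchy T"
    by (rule LIMSEQ_imp_Cauchy)
  have "Cauchy s"
  proof (rule metric_CauchyI)
    fix e :: real assume "e > 0"
    then obtain M where M: "\<And>m n. m \<ge> M \<Longrightarrow> n \<ge> M \<Longrightarrow> dist (T m) (T n) < e\<^sup>2"
      using \<open>Cauchy T\<close> unfolding Cauchy_def by (meson zero_less_power)
    have *: "norm (s n - s m) < e" if "M \<le> m" "m \<le> n" for m n
    proof -
      have "(norm (s n - s m))\<^sup>2 < e\<^sup>2"
        using M[of m n] that by (simp add: diff dist_real_def)
      then show ?thesis
        using \<open>e > 0\<close> by (simp add: power_less_imp_less_base)
    qed
    show "\<exists>M. \<forall>m\<ge>M. \<forall>n\<ge>M. dist (s m) (s n) < e"
      using * by (metis dist_norm norm_minus_commute nat_le_linear)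
  qed
  then obtain x where x: "s \<longlonglongrightarrow> x"
    using Cauchy_convergent_iff convergent_def by blast
  have "cinner x (\<psi> k) = c k" if "k \<ge> 1" for k
  proof -
    have "(\<lambda>N. cinner (s N) (\<psi> k)) \<longlonglongrightarrow> cinner x (\<psi> k)"
      by (rule bounded_linear.tendsto[OF bounded_linear_cinner_left x])
    moreover have "(\<lambda>N. cinner (s N) (\<psi> k)) \<longlonglongrightarrow> c k"
      using that by (intro tendsto_eventually eventually_sequentiallyI[of k])
        (simp add: s_def cinner_sum_basis[OF that] del: One_nat_def)
    ultimately show ?thesis
      by (rule LIMSEQ_unique)
  qed
  moreover have "(norm x)\<^sup>2 \<le> X"
  proof (rule LIMSEQ_le_const2)
    show "(\<lambda>N. (norm (s N))\<^sup>2) \<longlonglongrightarrow> (norm x)\<^sup>2"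
      by (intro tendsto_intros x)
    show "\<exists>N. \<forall>n\<ge>N. (norm (s n))\<^sup>2 \<le> X"
      using bound unfolding norm_s T_def by blast
  qed
  ultimately show ?thesis
    by blast
qed

lemma Parseval:
  "(\<lambda>N. \<Sum>k=1..N. cinner u (\<psi> k) * cnj (cinner v (\<psi> k))) \<longlonglongrightarrow> cinner u v"
proof -
  have "(\<lambda>N. cinner (\<Sum>k=1..N. cinner u (\<psi> k) *\<^sub>C \<psi> k) v) \<longlonglongrightarrow> cinner u v"
    by (intro bounded_linear.tendsto[OF bounded_linear_cinner_left] has_sum_imp_tendsto_from_1 expansion)
  then show ?thesis
    by (simp add: cinner_sum_left cinner_scaleC_left cinner_commute[of "\<psi> _" v])
qed

end

section \<open>The operators \<open>K(z)\<close> and \<open>B(z)\<close> in the eigenbasis\<close>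

text \<open>\<open>S\<close> plays the role of A^(1/2) with domain \<open>V\<close>. It enters
  through its linearity on \<open>V\<close>, its values on the eigenvectors and the identity
  \<open>assoc\<close>.\<close>

locale form_setting = hilbert_basis \<psi> for \<psi> :: "nat \<Rightarrow> 'h::chilbert_space" +
  fixes V :: "'h set" and a b :: "'h \<Rightarrow> 'h \<Rightarrow> complex" and S :: "'h \<Rightarrow> 'h"
    and \<mu> :: "nat \<Rightarrow> real" and \<alpha> M :: real
  assumes subspace: "csubspace V"
    and closed: "closed_form V a"
    and assoc: "\<And>u v. u \<in> V \<Longrightarrow> v \<in> V \<Longrightarrow> a u v = cinner (S u) (S v)"
    and S_add: "\<And>u v. u \<in> V \<Longrightarrow> v \<in> V \<Longrightarrow> S (u + v) = S u + S v"
    and S_scaleC: "\<And>c u. u \<in> V \<Longrightarrow> S (c *\<^sub>C u) = c *\<^sub>C S u"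
    and S_basis: "\<And>k. k \<ge> 1 \<Longrightarrow> S (\<psi> k) = sqrt (\<mu> k) *\<^sub>R \<psi> k"
    and basis_in: "\<And>k. k \<ge> 1 \<Longrightarrow> \<psi> k \<in> V"
    and \<mu>_pos: "\<And>k. k \<ge> 1 \<Longrightarrow> \<mu> k > 0"
    and sesq: "sesquilinear_on V b"
    and cont: "form_continuous_on V a b"
    and M_nonneg: "M \<ge> 0"
    and b_bound: "\<And>m n. m \<ge> 1 \<Longrightarrow> n \<ge> 1 \<Longrightarrow>
      norm (b (\<psi> m) (\<psi> n)) \<le> M * real m powr (- \<alpha>) * real n powr (- \<alpha>)"
begin

section \<open>Linear calculus for \<open>V\<close>, \<open>S\<close> and \<open>b\<close>\<close>

lemma V_add: "u \<in> V \<Longrightarrow> v \<in> V \<Longrightarrow> u + v \<in> V"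
  and V_scaleC: "u \<in> V \<Longrightarrow> c *\<^sub>C u \<in> V"
  and V_zero: "0 \<in> V"
  using subspace unfolding csubspace_def by auto

lemma V_diff: "u \<in> V \<Longrightarrow> v \<in> V \<Longrightarrow> u - v \<in> V"
  using V_add[of u "(-1) *\<^sub>C v"] V_scaleC[of v "-1"] by (simp add: scaleC_minus_one)

lemma V_sum: "(\<And>k. k \<in> F \<Longrightarrow> f k \<in> V) \<Longrightarrow> sum f F \<in> V"
  by (induction F rule: infinite_finite_induct) (auto simp: V_zero V_add)

lemma S_diff: "u \<in> V \<Longrightarrow> v \<in> V \<Longrightarrow> S (u - v) = S u - S v"
  using S_add[of u "(-1) *\<^sub>C v"] S_scaleC[of v "-1"] V_scaleC[of v "-1"]
  by (simp add: scaleC_minus_one)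

lemma S_zero: "S 0 = 0"
  using S_add[of 0 0] V_zero by simp

lemma S_sum: "(\<And>k. k \<in> F \<Longrightarrow> f k \<in> V) \<Longrightarrow> S (sum f F) = (\<Sum>k\<in>F. S (f k))"
  by (induction F rule: infinite_finite_induct) (auto simp: S_zero S_add V_sum)

lemma form_self: "u \<in> V \<Longrightarrow> Re (a u u) = (norm (S u))\<^sup>2"
  by (simp add: assoc cinner_self)

lemma b_add_left: "u \<in> V \<Longrightarrow> v \<in> V \<Longrightarrow> w \<in> V \<Longrightarrow> b (u + v) w = b u w + b v w"
  and b_add_right: "u \<in> V \<Longrightarrow> v \<in> V \<Longrightarrow> w \<in> V \<Longrightarrow> b w (u + v) = b w u + b w v"
  and b_scaleC_left: "u \<in> V \<Longrightarrow> w \<in> V \<Longrightarrow> b (c *\<^sub>C u) w = c * b u w"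
  and b_scaleC_right: "u \<in> V \<Longrightarrow> w \<in> V \<Longrightarrow> b w (c *\<^sub>C u) = cnj c * b w u"
  using sesq unfolding sesquilinear_on_def by auto

lemma b_zero_left: "w \<in> V \<Longrightarrow> b 0 w = 0"
  using b_add_left[of 0 0 w] V_zero by simp

lemma b_zero_right: "w \<in> V \<Longrightarrow> b w 0 = 0"
  using b_add_right[of 0 0 w] V_zero by simp

lemma b_diff_left: "u \<in> V \<Longrightarrow> v \<in> V \<Longrightarrow> w \<in> V \<Longrightarrow> b (u - v) w = b u w - b v w"
  using b_add_left[of u "(-1) *\<^sub>C v" w] b_scaleC_left[of v w "-1"] V_scaleC[of v "-1"]
  by (simp add: scaleC_minus_one)

lemma b_diff_right: "u \<in> V \<Longrightarrow> v \<in> V \<Longrightarrow> w \<in> V \<Longrightarrow> b w (u - v) = b w u - b w v"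
  using b_add_right[of u "(-1) *\<^sub>C v" w] b_scaleC_right[of v w "-1"] V_scaleC[of v "-1"]
  by (simp add: scaleC_minus_one)

lemma b_sum_left: "(\<And>k. k \<in> F \<Longrightarrow> f k \<in> V) \<Longrightarrow> w \<in> V \<Longrightarrow> b (sum f F) w = (\<Sum>k\<in>F. b (f k) w)"
  by (induction F rule: infinite_finite_induct) (auto simp: b_zero_left b_add_left V_sum)

lemma b_sum_right: "(\<And>k. k \<in> F \<Longrightarrow> f k \<in> V) \<Longrightarrow> w \<in> V \<Longrightarrow> b w (sum f F) = (\<Sum>k\<in>F. b w (f k))"
  by (induction F rule: infinite_finite_induct) (auto simp: b_zero_right b_add_right V_sum)

section \<open>Partial eigenvector expansions in the form norm\<close>

definition section_sum :: "nat \<Rightarrow> 'h \<Rightarrow> 'h" where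
  "section_sum N x = (\<Sum>k=1..N. cinner x (\<psi> k) *\<^sub>C \<psi> k)"

lemma section_sum_tendsto: "(\<lambda>N. section_sum N x) \<longlonglongrightarrow> x"
  unfolding section_sum_def by (intro has_sum_imp_tendsto_from_1 expansion)

lemma section_sum_in: "section_sum N x \<in> V"
  unfolding section_sum_def by (intro V_sum V_scaleC basis_in) auto

text \<open>Pythagoras again: \<open>S\<close> is diagonal in the basis with entries
  \<open>sqrt (\<mu> k)\<close>.\<close>

lemma norm_S_sum:
  assumes "finite F" "F \<subseteq> {1..}"
  shows "(norm (S (\<Sum>k\<in>F. c k *\<^sub>C \<psi> k)))\<^sup>2 = (\<Sum>k\<in>F. \<mu> k * (norm (c k))\<^sup>2)"
proof -
  have "S (\<Sum>k\<in>F. c k *\<^sub>C \<psi> k) = (\<Sum>k\<in>F. S (c k *\<^sub>C \<psi> k))"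
    using assms by (intro S_sum V_scaleC basis_in) auto
  also have "\<dots> = (\<Sum>k\<in>F. (c k * of_real (sqrt (\<mu> k))) *\<^sub>C \<psi> k)"
  proof (rule sum.cong)
    fix k assume "k \<in> F"
    then have "k \<ge> 1"
      using assms by auto
    then show "S (c k *\<^sub>C \<psi> k) = (c k * of_real (sqrt (\<mu> k))) *\<^sub>C \<psi> k"
      by (simp add: S_scaleC basis_in S_basis scaleC_complex_of_real[symmetric] scaleC_scaleC)
  qed simp
  finally have "(norm (S (\<Sum>k\<in>F. c k *\<^sub>C \<psi> k)))\<^sup>2 = (\<Sum>k\<in>F. (norm (c k * of_real (sqrt (\<mu> k))))\<^sup>2)"
    using assms by (simp only: norm_sum_basis)
  also have "\<dots> = (\<Sum>k\<in>F. \<mu> k * (norm (c k))\<^sup>2)"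
    using assms \<mu>_pos
    by (intro sum.cong) (auto simp: norm_mult power_mult_distrib less_imp_le)
  finally show ?thesis .
qed

context
  fixes x X
  assumes bound: "\<And>N. (\<Sum>k=1..N. \<mu> k * (norm (cinner x (\<psi> k)))\<^sup>2) \<le> X"
begin

text \<open>By \<open>norm_S_sum\<close> the form evaluated at a difference of two partial
  expansions is the difference of the corresponding partial sums \<open>T\<close>. Boundedness of
  \<open>T\<close> makes the partial expansions Cauchy for the form, and closedness puts their limit
  \<open>x\<close> into \<open>V\<close>. Membership in the form domain is thus read off from
  coefficients.\<close>

lemma form_domain: "x \<in> V"
  and section_sum_form_tendsto:
    "(\<lambda>N. Re (a (section_sum N x - x) (section_sum N x - x))) \<longlonglongrightarrow> 0"
proof -
  define T where "T = (\<lambda>N. \<Sum>k=1..N. \<mu> k * (norm (cinner x (\<psi> k)))\<^sup>2)"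
  have diff: "Re (a (section_sum n x - section_sum m x) (section_sum n x - section_sum m x)) = \<bar>T n - T m\<bar>"
    for m n
  proof -
    have *: "(norm (S (section_sum n x - section_sum m x)))\<^sup>2 = \<bar>T n - T m\<bar>" if "m \<le> n" for m n
    proof -
      have split: "{1..n} = {1..m} \<union> {m<..n}"
        using that by auto
      have 1: "section_sum n x - section_sum m x = (\<Sum>k\<in>{m<..n}. cinner x (\<psi> k) *\<^sub>C \<psi> k)"
        and 2: "T n - T m = (\<Sum>k\<in>{m<..n}. \<mu> k * (norm (cinner x (\<psi> k)))\<^sup>2)"
        unfolding T_def section_sum_def split by (subst sum.union_disjoint; force)+
      have "0 \<le> T n - T m"
        unfolding 2 using \<mu>_pos by (intro sum_nonneg mult_nonneg_nonneg) (auto simp: less_imp_le)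
      then show ?thesis
        unfolding 1 by (simp add: norm_S_sum subset_eq 2[symmetric])
    qed
    have "(norm (S (section_sum n x - section_sum m x)))\<^sup>2 = \<bar>T n - T m\<bar>"
    proof (cases "m \<le> n")
      case True
      then show ?thesis
        by (rule *)
    next
      case False
      have "norm (S (section_sum n x - section_sum m x)) = norm (S (section_sum m x - section_sum n x))"
        unfolding S_diff[OF section_sum_in section_sum_in] by (rule norm_minus_commute)
      then show ?thesis
        using *[of n m] False by (simp only: abs_minus_commute[of "T n"])
    qed
    then show ?thesis
      by (simp add: form_self V_diff section_sum_in)
  qed
  have "incseq T"
    unfolding T_def using \<mu>_pos by (intro incseq_SucI) (simp add: less_imp_le)
  moreover have "\<And>N. T N \<le> X"
    unfolding T_def by (rule bound)
  ultimately obtain L where "T \<longlonglongrightarrow> L"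
    by (metis incseq_convergent)
  then have "Cauchy T"
    by (rule LIMSEQ_imp_Cauchy)
  then have "\<forall>e>0. \<exists>N. \<forall>m\<ge>N. \<forall>n\<ge>N.
      Re (a (section_sum m x - section_sum n x) (section_sum m x - section_sum n x)) < e"
    unfolding diff Cauchy_def dist_real_def .
  then show "x \<in> V" "(\<lambda>N. Re (a (section_sum N x - x) (section_sum N x - x))) \<longlonglongrightarrow> 0"
    using closed[unfolded closed_form_def, rule_format, of "\<lambda>N. section_sum N x" x] section_sum_in section_sum_tendsto
    by auto
qed

lemma section_sum_form_norm_tendsto: "(\<lambda>N. form_norm a (section_sum N x - x)) \<longlonglongrightarrow> 0"
proof -
  have "(\<lambda>N. section_sum N x - x) \<longlonglongrightarrow> 0"
    using section_sum_tendsto[of x] by (simp add: LIM_zero_iff)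
  then have "(\<lambda>N. form_norm a (section_sum N x - x)) \<longlonglongrightarrow> sqrt ((norm (0::'h))\<^sup>2 + 0)"
    unfolding form_norm_def by (intro tendsto_intros section_sum_form_tendsto)
  then show ?thesis
    by simp
qed

text \<open>Form convergence says that \<open>S\<close> of the partial expansions tends to
  \<open>S x\<close>, and their squared norms are exactly the sums bounded by \<open>X\<close>.
  Coefficient estimates become estimates of A^(1/2) in this way.\<close>

lemma norm_S_le: "(norm (S x))\<^sup>2 \<le> X"
proof -
  have "(\<lambda>N. (norm (S (section_sum N x) - S x))\<^sup>2) \<longlonglongrightarrow> 0"
    using section_sum_form_tendsto
    by (simp add: form_self form_domain V_diff section_sum_in S_diff)
  then have "(\<lambda>N. sqrt ((norm (S (section_sum N x) - S x))\<^sup>2)) \<longlonglongrightarrow> sqrt 0"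
    by (rule tendsto_real_sqrt)
  then have "(\<lambda>N. S (section_sum N x)) \<longlonglongrightarrow> S x"
    by (simp add: LIM_zero_iff tendsto_norm_zero_iff)
  then have "(\<lambda>N. (norm (S (section_sum N x)))\<^sup>2) \<longlonglongrightarrow> (norm (S x))\<^sup>2"
    by (intro tendsto_intros)
  then show ?thesis
    by (rule LIMSEQ_le_const2) (use bound in \<open>auto simp: section_sum_def norm_S_sum subset_eq simp del: One_nat_def\<close>)
qed

text \<open>The partial expansions of \<open>x\<close> converge in the form norm, for which
  \<open>b\<close> is continuous. Norm convergence in the Hilbert space alone would not
  suffice.\<close>

lemma b_expansion_left:
  assumes "y \<in> V"
  shows "(\<lambda>N. \<Sum>k=1..N. cinner x (\<psi> k) * b (\<psi> k) y) \<longlonglongrightarrow> b x y"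
proof -
  obtain C where C: "\<And>u v. u \<in> V \<Longrightarrow> v \<in> V \<Longrightarrow> norm (b u v) \<le> C * form_norm a u * form_norm a v"
    using cont unfolding form_continuous_on_def by blast
  have "(\<lambda>N. b (section_sum N x) y - b x y) \<longlonglongrightarrow> 0"
  proof (rule Lim_null_comparison)
    have "(\<lambda>N. C * form_norm a (section_sum N x - x) * form_norm a y) \<longlonglongrightarrow> C * 0 * form_norm a y"
      by (intro tendsto_intros section_sum_form_norm_tendsto)
    then show "(\<lambda>N. C * form_norm a (section_sum N x - x) * form_norm a y) \<longlonglongrightarrow> 0"
      by simp
    show "\<forall>\<^sub>F N in sequentially. norm (b (section_sum N x) y - b x y)
        \<le> C * form_norm a (section_sum N x - x) * form_norm a y"
      unfolding b_diff_left[OF section_sum_in form_domain assms, symmetric]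
      by (intro always_eventually allI C V_diff section_sum_in form_domain assms)
  qed
  moreover have "b (section_sum N x) y = (\<Sum>k=1..N. cinner x (\<psi> k) * b (\<psi> k) y)" for N
    using assms unfolding section_sum_def by (subst b_sum_left) (auto simp: V_scaleC basis_in b_scaleC_left)
  ultimately show ?thesis
    by (simp add: LIM_zero_iff)
qed

lemma b_expansion_right:
  assumes "y \<in> V"
  shows "(\<lambda>N. \<Sum>k=1..N. cnj (cinner x (\<psi> k)) * b y (\<psi> k)) \<longlonglongrightarrow> b y x"
proof -
  obtain C where C: "\<And>u v. u \<in> V \<Longrightarrow> v \<in> V \<Longrightarrow> norm (b u v) \<le> C * form_norm a u * form_norm a v"
    using cont unfolding form_continuous_on_def by blast
  have "(\<lambda>N. b y (section_sum N x) - b y x) \<longlonglongrightarrow> 0"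
  proof (rule Lim_null_comparison)
    have "(\<lambda>N. C * form_norm a y * form_norm a (section_sum N x - x)) \<longlonglongrightarrow> C * form_norm a y * 0"
      by (intro tendsto_intros section_sum_form_norm_tendsto)
    then show "(\<lambda>N. C * form_norm a y * form_norm a (section_sum N x - x)) \<longlonglongrightarrow> 0"
      by simp
    show "\<forall>\<^sub>F N in sequentially. norm (b y (section_sum N x) - b y x)
        \<le> C * form_norm a y * form_norm a (section_sum N x - x)"
      unfolding b_diff_right[OF section_sum_in form_domain assms, symmetric]
      by (intro always_eventually allI C V_diff section_sum_in form_domain assms)
  qed
  moreover have "b y (section_sum N x) = (\<Sum>k=1..N. cnj (cinner x (\<psi> k)) * b y (\<psi> k))" for N
    using assms unfolding section_sum_def by (subst b_sum_right) (auto simp: V_scaleC basis_in b_scaleC_right)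
  ultimately show ?thesis
    by (simp add: LIM_zero_iff)
qed

end

end

text \<open>A fixed point \<open>z\<close> off the spectrum. The distance \<open>\<delta>\<close>
  makes \<open>K\<close> bounded with range in \<open>V\<close> but does not appear in
  \<open>integrand_bound\<close>; the quantitative information is in \<open>P\<close>.\<close>

locale resolvent_point = form_setting +
  fixes z :: complex and \<delta> P :: real
  assumes \<delta>_pos: "\<delta> > 0"
    and away: "\<And>k. k \<ge> 1 \<Longrightarrow> norm (z - of_real (\<mu> k)) \<ge> \<delta>"
    and weights: "\<And>N. (\<Sum>k=1..N. real k powr (- 2 * \<alpha>) / norm (z - of_real (\<mu> k))) \<le> P"
begin

text \<open>The eigenvalue of \<open>K\<close> at \<open>\<psi> k\<close>.\<close>

definition r :: "nat \<Rightarrow> complex" where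
  "r k = (z - of_real (\<mu> k)) powr (-1/2)"

definition p :: "nat \<Rightarrow> real" where
  "p k = real k powr (- \<alpha>) * norm (r k)"

abbreviation K :: "'a \<Rightarrow> 'a" where
  "K \<equiv> K_op \<mu> \<psi> z"

text \<open>The exponent is real, so the modulus of the power is independent of the branch of the
  argument. The branch cut therefore has no effect on any estimate.\<close>

lemma norm_r_power2:
  assumes "k \<ge> 1"
  shows "(norm (r k))\<^sup>2 = 1 / norm (z - of_real (\<mu> k))"
proof -
  let ?w = "z - of_real (\<mu> k)"
  have w: "norm ?w > 0"
    using away[OF assms] \<delta>_pos by linarith
  have "norm (r k) = norm ?w powr (-1/2)"
    unfolding r_def by (subst norm_powr_real_powr') auto
  then have "(norm (r k))\<^sup>2 = norm ?w powr (-1)"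
    by (simp add: power2_eq_square powr_add[symmetric])
  then show ?thesis
    using w powr_neg_one by simp
qed

lemma norm_r_le: "k \<ge> 1 \<Longrightarrow> (norm (r k))\<^sup>2 \<le> 1 / \<delta>"
  using away[of k] \<delta>_pos by (simp add: norm_r_power2 frac_le)

text \<open>The triangle inequality bounds \<open>\<mu> k\<close> by \<open>norm z\<close> plus the
  distance from \<open>z\<close>. This keeps \<open>sqrt (\<mu> k) * norm (r k)\<close> bounded in
  \<open>k\<close>, which is why \<open>K\<close> maps into the form domain.\<close>

lemma \<mu>_norm_r_le:
  assumes "k \<ge> 1"
  shows "\<mu> k * (norm (r k))\<^sup>2 \<le> 1 + norm z / \<delta>"
proof -
  let ?w = "norm (z - of_real (\<mu> k))"
  have w: "?w \<ge> \<delta>" "?w > 0"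
    using away[OF assms] \<delta>_pos by auto
  have "\<mu> k = norm (complex_of_real (\<mu> k))"
    using \<mu>_pos[OF assms] by simp
  also have "\<dots> \<le> norm z + ?w"
    using norm_triangle_ineq4[of z "z - of_real (\<mu> k)"] by simp
  finally have "\<mu> k / ?w \<le> (norm z + ?w) / ?w"
    using w by (intro divide_right_mono) auto
  also have "\<dots> \<le> 1 + norm z / \<delta>"
    using w \<delta>_pos by (simp add: add_divide_distrib frac_le)
  finally show ?thesis
    using assms by (simp add: norm_r_power2)
qed

lemma p_nonneg: "p k \<ge> 0"
  by (simp add: p_def)

lemma p_power2: "k \<ge> 1 \<Longrightarrow> (p k)\<^sup>2 = real k powr (- 2 * \<alpha>) / norm (z - of_real (\<mu> k))"
  by (simp add: p_def power_mult_distrib norm_r_power2 powr_power)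

lemma sum_p_power2_le: "(\<Sum>k=1..N. (p k)\<^sup>2) \<le> P"
  using weights[of N] by (simp add: p_power2)

lemma P_nonneg: "P \<ge> 0"
  using sum_p_power2_le[of 0] by simp

text \<open>The multiplier \<open>c\<close> is \<open>r\<close> for \<open>K\<close> and its complex
  conjugate for the adjoint; only the common modulus matters.\<close>

lemma multiplier_bound:
  assumes "\<And>k. k \<ge> 1 \<Longrightarrow> norm (c k) = norm (r k)"
  shows "(\<Sum>k=1..N. (norm (c k * cinner u (\<psi> k)))\<^sup>2) \<le> (norm u)\<^sup>2 / \<delta>"
proof -
  have "(\<Sum>k=1..N. (norm (c k * cinner u (\<psi> k)))\<^sup>2) \<le> (\<Sum>k=1..N. 1 / \<delta> * (norm (cinner u (\<psi> k)))\<^sup>2)"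
    by (intro sum_mono) (auto simp: norm_mult power_mult_distrib assms norm_r_le simp del: times_divide_eq_left
        intro!: mult_right_mono)
  also have "\<dots> = 1 / \<delta> * (\<Sum>k=1..N. (norm (cinner u (\<psi> k)))\<^sup>2)"
    by (simp add: sum_distrib_left)
  also have "\<dots> \<le> 1 / \<delta> * (norm u)\<^sup>2"
    using \<delta>_pos Bessel_partial by (intro mult_left_mono) auto
  finally show ?thesis
    by simp
qed

lemma multiplier_form_bound:
  assumes "\<And>k. k \<ge> 1 \<Longrightarrow> norm (c k) = norm (r k)"
    and "\<And>k. k \<ge> 1 \<Longrightarrow> cinner x (\<psi> k) = c k * cinner u (\<psi> k)"
  shows "(\<Sum>k=1..N. \<mu> k * (norm (cinner x (\<psi> k)))\<^sup>2) \<le> (1 + norm z / \<delta>) * (norm u)\<^sup>2"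
proof -
  have "(\<Sum>k=1..N. \<mu> k * (norm (cinner x (\<psi> k)))\<^sup>2)
      = (\<Sum>k=1..N. \<mu> k * (norm (r k))\<^sup>2 * (norm (cinner u (\<psi> k)))\<^sup>2)"
    by (intro sum.cong) (auto simp: assms norm_mult power_mult_distrib)
  also have "\<dots> \<le> (\<Sum>k=1..N. (1 + norm z / \<delta>) * (norm (cinner u (\<psi> k)))\<^sup>2)"
    by (intro sum_mono mult_right_mono \<mu>_norm_r_le) auto
  also have "\<dots> = (1 + norm z / \<delta>) * (\<Sum>k=1..N. (norm (cinner u (\<psi> k)))\<^sup>2)"
    by (simp add: sum_distrib_left)
  also have "\<dots> \<le> (1 + norm z / \<delta>) * (norm u)\<^sup>2"
    using \<delta>_pos Bessel_partial by (intro mult_left_mono) auto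
  finally show ?thesis .
qed

text \<open>Riesz-Fischer gives a vector with these coefficients, and its basis expansion is the
  series defining \<open>K u\<close>. This shows that the series is summable, so its infinite sum is
  not the default value.\<close>

lemma cinner_K:
  assumes "k \<ge> 1"
  shows "cinner (K u) (\<psi> k) = r k * cinner u (\<psi> k)"
proof -
  obtain x where x: "\<And>k. k \<ge> 1 \<Longrightarrow> cinner x (\<psi> k) = r k * cinner u (\<psi> k)"
    using Riesz_Fischer[OF multiplier_bound[of r u]] by auto
  have "((\<lambda>k. r k *\<^sub>C (cinner u (\<psi> k) *\<^sub>C \<psi> k)) has_sum x) {1..}"
    using expansion[of x]
    by (subst has_sum_cong[of _ _ "\<lambda>k. cinner x (\<psi> k) *\<^sub>C \<psi> k"]) (auto simp: x scaleC_scaleC)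
  then have "K u = x"
    unfolding K_op_def r_def by (rule infsumI)
  then show ?thesis
    using x assms by simp
qed

lemma K_add: "K (u + v) = K u + K v"
  by (rule vector_eqI) (simp add: cinner_K cinner_add_left algebra_simps)

lemma K_scaleC: "K (c *\<^sub>C u) = c *\<^sub>C K u"
  by (rule vector_eqI) (simp add: cinner_K cinner_scaleC_left)

lemma K_form_bound:
  "(\<Sum>k=1..N. \<mu> k * (norm (cinner (K u) (\<psi> k)))\<^sup>2) \<le> (1 + norm z / \<delta>) * (norm u)\<^sup>2"
  by (rule multiplier_form_bound[where c = r]) (auto simp: cinner_K)

lemma K_in: "K u \<in> V"
  by (rule form_domain[OF K_form_bound])

lemma cinner_cadjoint_K:
  assumes "k \<ge> 1"
  shows "cinner (cadjoint K v) (\<psi> k) = cnj (r k) * cinner v (\<psi> k)"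
proof -
  have "\<exists>x. \<forall>k\<ge>1. cinner x (\<psi> k) = cnj (r k) * cinner v (\<psi> k)" for v
    using Riesz_Fischer[OF multiplier_bound[of "\<lambda>k. cnj (r k)" v]] by auto
  then obtain L where L: "\<And>v k. k \<ge> 1 \<Longrightarrow> cinner (L v) (\<psi> k) = cnj (r k) * cinner v (\<psi> k)"
    by metis
  have "cinner (K u) v = cinner u (L v)" for u v
  proof (rule LIMSEQ_unique[OF Parseval])
    have "(\<Sum>k=1..N. cinner (K u) (\<psi> k) * cnj (cinner v (\<psi> k)))
        = (\<Sum>k=1..N. cinner u (\<psi> k) * cnj (cinner (L v) (\<psi> k)))" for N
      by (intro sum.cong) (auto simp: cinner_K L)
    then show "(\<lambda>N. \<Sum>k=1..N. cinner (K u) (\<psi> k) * cnj (cinner v (\<psi> k))) \<longlonglongrightarrow> cinner u (L v)"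
      using Parseval[of u "L v"] by simp
  qed
  then have "\<exists>L. \<forall>u v. cinner (K u) v = cinner u (L v)"
    by blast
  \<comment> \<open>The conjugate multiplier \<open>L\<close> is a witness, so the choice in
    \<open>cadjoint\<close> returns a genuine adjoint. Testing it on the eigenvectors of
    \<open>K\<close> fixes its coefficients.\<close>
  then have *: "\<forall>u v. cinner (K u) v = cinner u (cadjoint K v)"
    unfolding cadjoint_def by (rule someI_ex)
  have "K (\<psi> k) = r k *\<^sub>C \<psi> k"
    by (rule vector_eqI) (use assms in \<open>auto simp: cinner_K cinner_scaleC_left orthonormal\<close>)
  then have "cinner (\<psi> k) (cadjoint K v) = r k * cinner (\<psi> k) v"
    using * by (metis cinner_scaleC_left)
  then show ?thesis
    by (metis cinner_commute complex_cnj_mult)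
qed

lemma cadjoint_K_form_bound:
  "(\<Sum>k=1..N. \<mu> k * (norm (cinner (cadjoint K v) (\<psi> k)))\<^sup>2) \<le> (1 + norm z / \<delta>) * (norm v)\<^sup>2"
  by (rule multiplier_form_bound[where c = "\<lambda>k. cnj (r k)"]) (auto simp: cinner_cadjoint_K)

section \<open>The matrix of \<open>B\<close> and its powers\<close>

lemma B_entry_bound:
  assumes "m \<ge> 1" and X: "\<And>N. (\<Sum>j=1..N. p j * norm (cinner u (\<psi> j))) \<le> X"
  shows "norm (r m * b (K u) (\<psi> m)) \<le> M * p m * X"
proof -
  \<comment> \<open>The left-hand side of the lemma is the modulus of the \<open>m\<close>-th
    coefficient of \<open>B u\<close>: the adjoint of \<open>K\<close> multiplies
    \<open>\<psi> m\<close> by the conjugate of \<open>r m\<close>, and \<open>b\<close> is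
    conjugate-linear in its second argument. Expanding \<open>K u\<close> and inserting
    \<open>b_bound\<close> leaves one row of the rank-one matrix, with \<open>X\<close> bounding the
    pairing of \<open>p\<close> with the coefficients of \<open>u\<close>.\<close>
  have "norm (b (K u) (\<psi> m)) \<le> M * real m powr (- \<alpha>) * X"
  proof (rule LIMSEQ_le_const2)
    show "(\<lambda>N. norm (\<Sum>j=1..N. cinner (K u) (\<psi> j) * b (\<psi> j) (\<psi> m))) \<longlonglongrightarrow> norm (b (K u) (\<psi> m))"
      by (intro tendsto_norm b_expansion_left[OF K_form_bound] basis_in assms)
    have "norm (\<Sum>j=1..N. cinner (K u) (\<psi> j) * b (\<psi> j) (\<psi> m)) \<le> M * real m powr (- \<alpha>) * X" for N
    proof -
      have "norm (\<Sum>j=1..N. cinner (K u) (\<psi> j) * b (\<psi> j) (\<psi> m))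
          \<le> (\<Sum>j=1..N. norm (cinner (K u) (\<psi> j)) * norm (b (\<psi> j) (\<psi> m)))"
        by (rule order_trans[OF norm_sum]) (simp add: norm_mult)
      also have "\<dots> \<le> (\<Sum>j=1..N. (norm (r j) * norm (cinner u (\<psi> j)))
          * (M * real j powr (- \<alpha>) * real m powr (- \<alpha>)))"
        using assms by (intro sum_mono mult_mono b_bound) (auto simp: cinner_K norm_mult)
      also have "\<dots> = M * real m powr (- \<alpha>) * (\<Sum>j=1..N. p j * norm (cinner u (\<psi> j)))"
        by (simp add: p_def sum_distrib_left mult_ac)
      also have "\<dots> \<le> M * real m powr (- \<alpha>) * X"
        using M_nonneg by (intro mult_left_mono X) auto
      finally show ?thesis .
    qed
    then show "\<exists>N0. \<forall>N\<ge>N0. norm (\<Sum>j=1..N. cinner (K u) (\<psi> j) * b (\<psi> j) (\<psi> m)) \<le> M * real m powr (- \<alpha>) * X"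
      by blast
  qed
  then have "norm (r m) * norm (b (K u) (\<psi> m)) \<le> norm (r m) * (M * real m powr (- \<alpha>) * X)"
    by (rule mult_left_mono) simp
  then show ?thesis
    by (simp add: norm_mult p_def mult_ac)
qed

text \<open>The matrix coefficients are square summable by rank-one domination, so Riesz-Fischer
  builds \<open>T\<close>, with norm at most \<open>M * P\<close>. Parseval together with the
  expansion of \<open>b\<close> in its second argument identifies it with the form.\<close>

lemma B_op_exists:
  "\<exists>T. bounded_clinear T \<and> (\<forall>u v. cinner (T u) v = b (K u) (cadjoint K v)) \<and>
     (\<forall>u. \<forall>m\<ge>1. cinner (T u) (\<psi> m) = r m * b (K u) (\<psi> m))"
proof -
  have "\<exists>x. (\<forall>m\<ge>1. cinner x (\<psi> m) = r m * b (K u) (\<psi> m)) \<and> (norm x)\<^sup>2 \<le> (M * P * norm u)\<^sup>2" for u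
  proof (rule Riesz_Fischer)
    fix N
    \<comment> \<open>Cauchy-Schwarz contributes one factor \<open>sqrt P\<close>; summing the
      squares of \<open>p m\<close> over the rows below contributes the other.\<close>
    have X: "(\<Sum>j=1..N. p j * norm (cinner u (\<psi> j))) \<le> sqrt P * norm u" for N
      using sum_mult_le_sqrt[OF sum_p_power2_le Bessel_partial[where x = u]] by simp
    have "(\<Sum>m=1..N. (norm (r m * b (K u) (\<psi> m)))\<^sup>2) \<le> (\<Sum>m=1..N. (M * p m * (sqrt P * norm u))\<^sup>2)"
      by (intro sum_mono power_mono B_entry_bound[OF _ X]) auto
    also have "\<dots> = (M * norm u)\<^sup>2 * P * (\<Sum>m=1..N. (p m)\<^sup>2)"
      using P_nonneg by (simp add: power_mult_distrib sum_distrib_left mult_ac)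
    also have "\<dots> \<le> (M * norm u)\<^sup>2 * P * P"
      using P_nonneg by (intro mult_left_mono sum_p_power2_le) auto
    also have "\<dots> = (M * P * norm u)\<^sup>2"
      by (simp add: power2_eq_square)
    finally show "(\<Sum>m=1..N. (norm (r m * b (K u) (\<psi> m)))\<^sup>2) \<le> (M * P * norm u)\<^sup>2" .
  qed
  then obtain T where T: "\<And>u m. m \<ge> 1 \<Longrightarrow> cinner (T u) (\<psi> m) = r m * b (K u) (\<psi> m)"
    and T_norm: "\<And>u. (norm (T u))\<^sup>2 \<le> (M * P * norm u)\<^sup>2"
    by metis
  have T_add: "T (u + v) = T u + T v" for u v
    by (rule vector_eqI) (simp add: T K_add b_add_left K_in basis_in cinner_add_left algebra_simps)
  have T_scaleC: "T (c *\<^sub>C u) = c *\<^sub>C T u" for c u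
    by (rule vector_eqI) (simp add: T K_scaleC b_scaleC_left K_in basis_in cinner_scaleC_left)
  have "bounded_linear T"
  proof (rule bounded_linear_intro[where K = "M * P"])
    show "T (s *\<^sub>R u) = s *\<^sub>R T u" for s u
      using T_scaleC[of "of_real s" u] by (simp add: scaleC_complex_of_real)
    show "norm (T u) \<le> norm u * (M * P)" for u
      using power2_le_imp_le[OF T_norm, of u] M_nonneg P_nonneg by (simp add: mult_ac)
  qed (rule T_add)
  moreover have "cinner (T u) v = b (K u) (cadjoint K v)" for u v
  proof (rule LIMSEQ_unique[OF Parseval])
    have "(\<Sum>k=1..N. cinner (T u) (\<psi> k) * cnj (cinner v (\<psi> k)))
        = (\<Sum>k=1..N. cnj (cinner (cadjoint K v) (\<psi> k)) * b (K u) (\<psi> k))" for N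
      by (intro sum.cong) (auto simp: T cinner_cadjoint_K)
    then show "(\<lambda>N. \<Sum>k=1..N. cinner (T u) (\<psi> k) * cnj (cinner v (\<psi> k))) \<longlonglongrightarrow> b (K u) (cadjoint K v)"
      using b_expansion_right[OF cadjoint_K_form_bound K_in, of v u] by simp
  qed
  ultimately show ?thesis
    unfolding bounded_clinear_def using T T_scaleC by blast
qed

abbreviation B :: "'a \<Rightarrow> 'a" where
  "B \<equiv> B_op \<mu> \<psi> b z"

text \<open>An operator is determined by its inner products with all vectors, so the definite
  description in \<open>B_op\<close> denotes the operator already built.\<close>

lemma cinner_B:
  assumes "m \<ge> 1"
  shows "cinner (B u) (\<psi> m) = r m * b (K u) (\<psi> m)"
proof -
  obtain T where T: "bounded_clinear T" "\<And>u v. cinner (T u) v = b (K u) (cadjoint K v)"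
    "\<And>u m. m \<ge> 1 \<Longrightarrow> cinner (T u) (\<psi> m) = r m * b (K u) (\<psi> m)"
    using B_op_exists by blast
  have "B = T"
    unfolding B_op_def
  proof (rule the_equality)
    show "bounded_clinear T \<and> (\<forall>u v. cinner (T u) v = b (K u) (cadjoint K v))"
      using T by blast
  next
    fix T' assume "bounded_clinear T' \<and> (\<forall>u v. cinner (T' u) v = b (K u) (cadjoint K v))"
    then show "T' = T"
      using T(2) by (intro ext vector_eqI) simp
  qed
  then show ?thesis
    using T(3) assms by simp
qed

text \<open>A matrix dominated by \<open>M * p m * p j\<close> maps coefficients bounded by a
  multiple of \<open>p j\<close> to coefficients bounded by a multiple of \<open>p m\<close>,
  enlarging the constant by at most \<open>M * P\<close>. The first application produces this shape,
  since \<open>K (\<psi> n)\<close> has the single coefficient \<open>r n\<close>; hence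
  \<open>P\<close> occurs one time less than \<open>M\<close>.\<close>

lemma B_power_bound:
  assumes "m \<ge> 1" "n \<ge> 1"
  shows "norm (cinner ((B ^^ Suc k) (K (\<psi> n))) (\<psi> m)) \<le> M ^ Suc k * P ^ k * p m * p n * norm (r n)"
  using assms(1)
proof (induction k arbitrary: m)
  case 0
  have "(\<Sum>j=1..N. p j * norm (cinner (K (\<psi> n)) (\<psi> j))) \<le> p n * norm (r n)" for N
  proof -
    have "(\<Sum>j=1..N. p j * norm (cinner (K (\<psi> n)) (\<psi> j)))
        = (\<Sum>j=1..N. if j = n then p n * norm (r n) else 0)"
      using assms by (intro sum.cong) (auto simp: cinner_K orthonormal norm_mult)
    also have "\<dots> \<le> p n * norm (r n)"
      by (simp add: p_nonneg)
    finally show ?thesis .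
  qed
  from B_entry_bound[OF 0 this] show ?case
    using 0 by (simp add: cinner_B mult_ac)
next
  case (Suc k)
  have "(\<Sum>j=1..N. p j * norm (cinner ((B ^^ Suc k) (K (\<psi> n))) (\<psi> j)))
      \<le> M ^ Suc k * P ^ Suc k * p n * norm (r n)" for N
  proof -
    have "(\<Sum>j=1..N. p j * norm (cinner ((B ^^ Suc k) (K (\<psi> n))) (\<psi> j)))
        \<le> (\<Sum>j=1..N. p j * (M ^ Suc k * P ^ k * p j * p n * norm (r n)))"
      by (intro sum_mono mult_left_mono Suc.IH) (auto simp: p_nonneg)
    also have "\<dots> = M ^ Suc k * P ^ k * p n * norm (r n) * (\<Sum>j=1..N. (p j)\<^sup>2)"
      by (simp add: sum_distrib_left power2_eq_square mult_ac)
    also have "\<dots> \<le> M ^ Suc k * P ^ k * p n * norm (r n) * P"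
      using M_nonneg P_nonneg p_nonneg by (intro mult_left_mono sum_p_power2_le) auto
    finally show ?thesis
      by (simp add: mult_ac)
  qed
  from B_entry_bound[OF Suc.prems this] show ?case
    using Suc.prems by (simp add: cinner_B mult_ac)
qed

text \<open>The outer \<open>K\<close> supplies a second factor \<open>norm (r m)\<close>, so the
  half powers combine to full reciprocal distances at both \<open>m\<close> and
  \<open>n\<close>.\<close>

lemma integrand_bound:
  assumes "m \<ge> 1" "n \<ge> 1"
  shows "norm (cinner (K ((B ^^ Suc k) (K (\<psi> n)))) (\<psi> m))
    \<le> M ^ Suc k * P ^ k * real m powr (- \<alpha>) * real n powr (- \<alpha>)
        / (norm (z - of_real (\<mu> m)) * norm (z - of_real (\<mu> n)))"
proof -
  have "norm (cinner (K ((B ^^ Suc k) (K (\<psi> n)))) (\<psi> m))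
      \<le> norm (r m) * (M ^ Suc k * P ^ k * p m * p n * norm (r n))"
    unfolding cinner_K[OF assms(1)] norm_mult
    by (intro mult_left_mono B_power_bound assms) simp
  also have "\<dots> = M ^ Suc k * P ^ k * real m powr (- \<alpha>) * real n powr (- \<alpha>) * ((norm (r m))\<^sup>2 * (norm (r n))\<^sup>2)"
    by (simp add: p_def power2_eq_square mult_ac)
  finally show ?thesis
    using assms by (simp add: norm_r_power2)
qed

end

section \<open>Weighted sums over the spectrum\<close>

lemma powr_comparable:
  fixes x y s :: real
  assumes "0 < y" "y / 2 \<le> x" "x \<le> 2 * y"
  shows "2 powr (- \<bar>s\<bar>) * y powr s \<le> x powr s" "x powr s \<le> 2 powr \<bar>s\<bar> * y powr s"
proof -
  have x: "x > 0" and q: "1 / 2 \<le> x / y" "x / y \<le> 2"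
    using assms by (auto simp: field_simps)
  have split: "x powr s = (x / y) powr s * y powr s"
    using x assms by (simp add: powr_divide)
  have half: "(1 / 2) powr t = 2 powr (- t)" for t :: real
    by (simp add: powr_divide powr_minus divide_simps)
  \<comment> \<open>The power is increasing or decreasing according to the sign of \<open>s\<close>;
    the absolute value covers both cases.\<close>
  have "2 powr (- \<bar>s\<bar>) \<le> (x / y) powr s \<and> (x / y) powr s \<le> 2 powr \<bar>s\<bar>"
  proof (cases "s \<ge> 0")
    case True
    then show ?thesis
      using powr_mono2[of s "1 / 2" "x / y"] powr_mono2[of s "x / y" 2] q by (simp add: half)
  next
    case False
    then show ?thesis
      using powr_mono2'[of s "1 / 2" "x / y"] powr_mono2'[of s "x / y" 2] q x assms
      by (simp add: half)
  qed
  then show "2 powr (- \<bar>s\<bar>) * y powr s \<le> x powr s" "x powr s \<le> 2 powr \<bar>s\<bar> * y powr s"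
    unfolding split by (auto intro!: mult_right_mono)
qed

text \<open>By the mean value theorem \<open>(s - 1)\<close> times each term is at most a decrement
  of x^(1 - s), and the decrements telescope.\<close>

lemma sum_powr_tail_le:
  fixes s :: real
  assumes "s > 1" "n \<ge> 1"
  shows "(\<Sum>m=n+1..N. real m powr (- s)) \<le> real n powr (1 - s) / (s - 1)"
proof -
  have step: "(s - 1) * real (Suc m) powr (- s) \<le> real m powr (1 - s) - real (Suc m) powr (1 - s)"
    if "m \<ge> 1" for m
  proof -
    have "((\<lambda>x. x powr (1 - s)) has_real_derivative (1 - s) * x powr (- s)) (at x)"
      if "real m \<le> x" for x
      using that \<open>m \<ge> 1\<close> by (auto intro!: derivative_eq_intros)
    then obtain \<xi> where \<xi>: "\<xi> > real m" "\<xi> < real m + 1"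
      "(real m + 1) powr (1 - s) - real m powr (1 - s) = (real m + 1 - real m) * ((1 - s) * \<xi> powr (- s))"
      using MVT2[of "real m" "real m + 1" "\<lambda>x. x powr (1 - s)" "\<lambda>x. (1 - s) * x powr (- s)"] by auto
    have "(real m + 1) powr (- s) \<le> \<xi> powr (- s)"
      using \<xi> that assms by (intro powr_mono2') auto
    then have "(s - 1) * (real m + 1) powr (- s) \<le> (s - 1) * \<xi> powr (- s)"
      using assms by (intro mult_left_mono) auto
    then show ?thesis
      using \<xi>(3) by (simp add: algebra_simps)
  qed
  \<comment> \<open>Using \<open>max n N\<close> instead of \<open>N\<close> makes both sides vanish
    while the sum is empty, so the induction can start at 0.\<close>
  have "(s - 1) * (\<Sum>m=n+1..N. real m powr (- s)) \<le> real n powr (1 - s) - real (max n N) powr (1 - s)"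
  proof (induction N)
    case 0
    then show ?case by simp
  next
    case (Suc N)
    show ?case
    proof (cases "n \<le> N")
      case True
      then have "{n + 1..Suc N} = insert (Suc N) {n + 1..N}"
        by auto
      then have "(s - 1) * (\<Sum>m=n+1..Suc N. real m powr (- s))
          = (s - 1) * (\<Sum>m=n+1..N. real m powr (- s)) + (s - 1) * real (Suc N) powr (- s)"
        by (simp add: algebra_simps)
      also have "\<dots> \<le> (real n powr (1 - s) - real N powr (1 - s))
          + (real N powr (1 - s) - real (Suc N) powr (1 - s))"
        using Suc True step[of N] assms by (intro add_mono) (auto simp: max_def)
      finally show ?thesis
        using True by (simp add: max_def)
    next
      case False
      then show ?thesis
        by (cases "n = Suc N") (auto simp: max_def)
    qed
  qed
  then have "(s - 1) * (\<Sum>m=n+1..N. real m powr (- s)) \<le> real n powr (1 - s)"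
    by (rule order_trans) simp
  then show ?thesis
    using assms by (simp add: field_simps)
qed

lemma sum_powr_le:
  fixes s :: real
  assumes "s > 1"
  shows "(\<Sum>m=1..N. real m powr (- s)) \<le> 1 + 1 / (s - 1)"
proof (cases "N \<ge> 1")
  case True
  then have "{1..N} = insert 1 {1 + 1..N}"
    by auto
  then show ?thesis
    using sum_powr_tail_le[OF assms, of 1 N] by simp
next
  case False
  then show ?thesis
    using assms by simp
qed

lemma sum_inverse_le_ln:
  assumes "n \<ge> 1"
  shows "(\<Sum>m=1..n. 1 / real m) \<le> ln (exp 1 * real n)"
  using assms
proof (induction n rule: dec_induct)
  case base
  then show ?case by simp
next
  case (step n)
  have "ln (real n / real (Suc n)) \<le> real n / real (Suc n) - 1"
    using step by (intro ln_le_minus_one) auto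
  then have "1 / real (Suc n) \<le> ln (real (Suc n)) - ln (real n)"
    using step by (simp add: ln_div field_simps)
  moreover have "ln (exp 1 * real n) = 1 + ln (real n)" "ln (exp 1 * real (Suc n)) = 1 + ln (real (Suc n))"
    using step by (simp_all add: ln_mult)
  ultimately show ?case
    using step by simp
qed

lemma ln_exp_mult_ge_1: "n \<ge> 1 \<Longrightarrow> 1 \<le> ln (exp 1 * real n)"
  by (simp add: ln_mult)

lemma \<sigma>_rate_nonneg: "n \<ge> 1 \<Longrightarrow> 0 \<le> \<sigma>_rate \<omega> \<gamma> n"
  by (auto simp: \<sigma>_rate_def intro!: mult_nonneg_nonneg order_trans[OF zero_le_one ln_exp_mult_ge_1])

lemma \<tau>_rate_nonneg: "0 \<le> \<tau>_rate \<omega> \<gamma> n"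
  by (simp add: \<tau>_rate_def)

text \<open>Apply ln x \<le> x - 1 to x = n^e. It absorbs the logarithm when \<open>\<omega>\<close>
  exceeds 1.\<close>

lemma ln_exp_mult_le_powr:
  assumes "e > 0" "n \<ge> 1"
  shows "ln (exp 1 * real n) \<le> (1 + 1 / e) * real n powr e"
proof -
  have "e * ln (real n) = ln (real n powr e)"
    using assms by (simp add: ln_powr)
  also have "\<dots> \<le> real n powr e"
    using assms by (intro order_trans[OF ln_le_minus_one]) auto
  finally have "ln (real n) \<le> real n powr e / e"
    using assms by (simp add: field_simps)
  moreover have "1 \<le> real n powr e"
    using assms by (simp add: ge_one_powr_ge_zero)
  ultimately show ?thesis
    using assms by (simp add: ln_mult algebra_simps)
qed

text \<open>Each distance from \<open>n\<close> is attained at most once on either side, which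
  explains the factor 2. The term \<open>m = n\<close> gives \<open>h 1\<close>, because the
  distance is cut off at 1.\<close>

lemma sum_distance_le:
  fixes h :: "real \<Rightarrow> real"
  assumes "n \<ge> 1" and nonneg: "\<And>x. h x \<ge> 0"
  shows "(\<Sum>m=1..2*n. h (max 1 \<bar>real n - real m\<bar>)) \<le> h 1 + 2 * (\<Sum>j=1..n. h (real j))"
proof -
  have "sum f {1..2*n} = sum f {1..<n} + (f n + sum f {n+1..2*n})" for f :: "nat \<Rightarrow> real"
  proof -
    have "{1..2*n} = {1..<n} \<union> ({n} \<union> {n+1..2*n})" "{1..<n} \<inter> {n+1..2*n} = {}"
      using assms by auto
    then show ?thesis
      by (simp add: sum.union_disjoint)
  qed
  from this[of "\<lambda>m. h (max 1 \<bar>real n - real m\<bar>)"]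
  have "(\<Sum>m=1..2*n. h (max 1 \<bar>real n - real m\<bar>)) = (\<Sum>m=1..<n. h (max 1 \<bar>real n - real m\<bar>))
      + (h 1 + (\<Sum>m=n+1..2*n. h (max 1 \<bar>real n - real m\<bar>)))"
    by simp
  moreover have "(\<Sum>m=1..<n. h (max 1 \<bar>real n - real m\<bar>)) = (\<Sum>j=1..<n. h (real j))"
    by (rule sum.reindex_bij_witness[of _ "\<lambda>j. n - j" "\<lambda>m. n - m"]) (auto simp: of_nat_diff max_def)
  moreover have "(\<Sum>m=n+1..2*n. h (max 1 \<bar>real n - real m\<bar>)) = (\<Sum>j=1..n. h (real j))"
    by (rule sum.reindex_bij_witness[of _ "\<lambda>j. n + j" "\<lambda>m. m - n"]) (auto simp: of_nat_diff max_def)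
  moreover have "(\<Sum>j=1..<n. h (real j)) \<le> (\<Sum>j=1..n. h (real j))"
    by (rule sum_mono2) (auto simp: nonneg)
  ultimately show ?thesis
    by simp
qed

text \<open>The indices are split at n/2 and 2n. Since the majorants are nonnegative, each may be
  summed over a larger range with convenient endpoints.\<close>

lemma sum_three_regions:
  fixes g :: "nat \<Rightarrow> real"
  assumes "n \<ge> 1"
    and "\<And>m. 1 \<le> m \<Longrightarrow> 2 * m \<le> n \<Longrightarrow> g m \<le> f1 m"
    and "\<And>m. n < 2 * m \<Longrightarrow> m < 2 * n \<Longrightarrow> g m \<le> f2 m"
    and "\<And>m. 2 * n \<le> m \<Longrightarrow> g m \<le> f3 m"
    and "\<And>m. f1 m \<ge> 0" "\<And>m. f2 m \<ge> 0" "\<And>m. f3 m \<ge> 0"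
  shows "(\<Sum>m=1..N. g m) \<le> (\<Sum>m=1..n. f1 m) + (\<Sum>m=1..2*n. f2 m) + (\<Sum>m=n+1..N. f3 m)"
proof -
  have "(\<Sum>m=1..N. g m) \<le> (\<Sum>m=1..N. (if m \<in> {1..n} then f1 m else 0)
      + (if m \<in> {1..2*n} then f2 m else 0) + (if m \<in> {n+1..N} then f3 m else 0))"
  proof (rule sum_mono)
    fix m assume m: "m \<in> {1..N}"
    consider "2 * m \<le> n" | "n < 2 * m" "m < 2 * n" | "2 * n \<le> m"
      by linarith
    then show "g m \<le> (if m \<in> {1..n} then f1 m else 0)
      + (if m \<in> {1..2*n} then f2 m else 0) + (if m \<in> {n+1..N} then f3 m else 0)"
    proof cases
      case 1
      then have "g m \<le> f1 m" using assms(2) m by auto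
      then show ?thesis using 1 m assms(5-7)[of m] by auto
    next
      case 2
      then have "g m \<le> f2 m" using assms(3) m by auto
      then show ?thesis using 2 m assms(5-7)[of m] by auto
    next
      case 3
      then have "g m \<le> f3 m" using assms(4) m by auto
      then show ?thesis using 3 m assms(1) assms(5-7)[of m] by auto
    qed
  qed
  also have "\<dots> = (\<Sum>m\<in>{1..N} \<inter> {1..n}. f1 m) + (\<Sum>m\<in>{1..N} \<inter> {1..2*n}. f2 m)
      + (\<Sum>m\<in>{1..N} \<inter> {n+1..N}. f3 m)"
    by (simp only: sum.distrib sum.inter_restrict finite_atLeastAtMost)
  also have "\<dots> \<le> (\<Sum>m=1..n. f1 m) + (\<Sum>m=1..2*n. f2 m) + (\<Sum>m=n+1..N. f3 m)"
    using assms by (intro add_mono sum_mono2) auto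
  finally show ?thesis .
qed

text \<open>A lower bound, up to a constant, for the distance between the eigenvalues \<open>\<mu>\<^sub>n\<close> and \<open>\<mu>\<^sub>m\<close>.\<close>

definition gap_model :: "real \<Rightarrow> nat \<Rightarrow> nat \<Rightarrow> real" where
  "gap_model \<gamma> n m = (if 2 * m \<le> n then real n powr \<gamma>
     else if m < 2 * n then real n powr (\<gamma> - 1) * max 1 \<bar>real n - real m\<bar>
     else real m powr \<gamma>)"

lemma gap_model_pos: "n \<ge> 1 \<Longrightarrow> m \<ge> 1 \<Longrightarrow> gap_model \<gamma> n m > 0"
  by (auto simp: gap_model_def)

text \<open>Used for \<open>i = 1\<close> and \<open>i = 2\<close>. Below n/2 the gap is constant,
  leaving the power sum \<open>X\<close>; around \<open>n\<close> the weight is comparable to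
  \<open>real n powr (- \<omega>)\<close>, leaving the sum \<open>Y\<close> over distances; above 2n
  a convergent tail remains.\<close>

lemma sum_gap_model_le:
  fixes \<omega> \<gamma> :: real
  assumes \<gamma>: "\<gamma> > 0" "\<omega> + \<gamma> > 1" and n: "n \<ge> 1" and "i \<ge> 1"
    and first: "(\<Sum>m=1..n. real m powr (- \<omega>)) \<le> X"
    and second: "(\<Sum>j=1..n. 1 / real j ^ i) \<le> Y"
  shows "(\<Sum>m=1..N. real m powr (- \<omega>) / gap_model \<gamma> n m ^ i) \<le>
    real n powr (- real i * \<gamma>) * X + 2 powr \<bar>\<omega>\<bar> * real n powr (real i - \<omega> - real i * \<gamma>) * (1 + 2 * Y)
      + real n powr (1 - \<omega> - real i * \<gamma>) / (\<omega> + \<gamma> - 1)"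
proof -
  have power_powr: "(real n powr t) ^ i = real n powr (real i * t)" if "n \<ge> 1" for n :: nat and t :: real
    using that by (simp add: powr_power)
  let ?f1 = "\<lambda>m. real n powr (- real i * \<gamma>) * real m powr (- \<omega>)"
  let ?f2 = "\<lambda>m. 2 powr \<bar>\<omega>\<bar> * real n powr (real i - \<omega> - real i * \<gamma>) * (1 / max 1 \<bar>real n - real m\<bar> ^ i)"
  let ?f3 = "\<lambda>m. real n powr (- (real i - 1) * \<gamma>) * real m powr (- (\<omega> + \<gamma>))"
  have "(\<Sum>m=1..N. real m powr (- \<omega>) / gap_model \<gamma> n m ^ i)
      \<le> (\<Sum>m=1..n. ?f1 m) + (\<Sum>m=1..2*n. ?f2 m) + (\<Sum>m=n+1..N. ?f3 m)"
  proof (rule sum_three_regions[OF n])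
    fix m :: nat assume "1 \<le> m" "2 * m \<le> n"
    then show "real m powr (- \<omega>) / gap_model \<gamma> n m ^ i \<le> ?f1 m"
      by (simp add: gap_model_def power_powr powr_minus field_simps)
  next
    fix m :: nat assume m: "n < 2 * m" "m < 2 * n"
    have "real m powr (- \<omega>) \<le> 2 powr \<bar>\<omega>\<bar> * real n powr (- \<omega>)"
      using powr_comparable(2)[of "real n" "real m" "- \<omega>"] m n by simp
    then have "real m powr (- \<omega>) / gap_model \<gamma> n m ^ i \<le> 2 powr \<bar>\<omega>\<bar> * real n powr (- \<omega>) / gap_model \<gamma> n m ^ i"
      using gap_model_pos[of n m \<gamma>] m by (intro divide_right_mono) auto
    also have "\<dots> = 2 powr \<bar>\<omega>\<bar> * (real n powr (- \<omega>) / real n powr (real i * (\<gamma> - 1))) * (1 / max 1 \<bar>real n - real m\<bar> ^ i)"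
      using m by (simp add: gap_model_def power_powr power_mult_distrib)
    also have "real n powr (- \<omega>) / real n powr (real i * (\<gamma> - 1)) = real n powr (real i - \<omega> - real i * \<gamma>)"
      by (simp add: powr_diff[symmetric] algebra_simps)
    finally show "real m powr (- \<omega>) / gap_model \<gamma> n m ^ i \<le> ?f2 m" .
  next
    fix m :: nat assume m: "2 * n \<le> m"
    have "real m powr (- \<omega>) / gap_model \<gamma> n m ^ i = real m powr (- ((real i - 1) * \<gamma>)) * real m powr (- (\<omega> + \<gamma>))"
      using m n by (simp add: gap_model_def power_powr powr_diff[symmetric] powr_add[symmetric] algebra_simps)
    \<comment> \<open>One factor \<open>real m powr (- \<gamma>)\<close> is kept to make the
      exponent \<omega> + \<gamma> > 1 summable; the other \<open>i - 1\<close> factors are bounded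
      by their values at \<open>n\<close>.\<close>
    also have "\<dots> \<le> real n powr (- ((real i - 1) * \<gamma>)) * real m powr (- (\<omega> + \<gamma>))"
      using m n \<gamma> \<open>i \<ge> 1\<close> by (intro mult_right_mono powr_mono2') (auto simp: mult_nonneg_nonneg)
    finally show "real m powr (- \<omega>) / gap_model \<gamma> n m ^ i \<le> ?f3 m"
      by (simp only: mult_minus_left)
  qed auto
  also have "\<dots> \<le> real n powr (- real i * \<gamma>) * X + 2 powr \<bar>\<omega>\<bar> * real n powr (real i - \<omega> - real i * \<gamma>) * (1 + 2 * Y)
      + real n powr (- (real i - 1) * \<gamma>) * (real n powr (1 - (\<omega> + \<gamma>)) / (\<omega> + \<gamma> - 1))"
    unfolding sum_distrib_left[symmetric]
  proof (intro add_mono mult_left_mono first)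
    show "(\<Sum>m=n+1..N. real m powr (- (\<omega> + \<gamma>))) \<le> real n powr (1 - (\<omega> + \<gamma>)) / (\<omega> + \<gamma> - 1)"
      using \<gamma> n by (intro sum_powr_tail_le) auto
    show "(\<Sum>m=1..2*n. 1 / max 1 \<bar>real n - real m\<bar> ^ i) \<le> 1 + 2 * Y"
      using sum_distance_le[OF n, of "\<lambda>x. 1 / \<bar>x\<bar> ^ i"] second by simp
  qed auto
  also have "real n powr (- (real i - 1) * \<gamma>) * (real n powr (1 - (\<omega> + \<gamma>)) / (\<omega> + \<gamma> - 1))
      = real n powr (1 - \<omega> - real i * \<gamma>) / (\<omega> + \<gamma> - 1)"
    by (simp add: powr_add[symmetric] algebra_simps)
  finally show ?thesis .
qed

lemma sum_powr_minus_le: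
  fixes \<omega> t :: real
  assumes "\<omega> \<le> t"
  shows "(\<Sum>m=1..n. real m powr (- \<omega>)) \<le> real n powr (t - \<omega>) * (\<Sum>m=1..n. real m powr (- t))"
  unfolding sum_distrib_left
proof (rule sum_mono)
  fix m assume m: "m \<in> {1..n}"
  have "real m powr (- \<omega>) = real m powr (t - \<omega>) * real m powr (- t)"
    by (simp add: powr_add[symmetric])
  also have "\<dots> \<le> real n powr (t - \<omega>) * real m powr (- t)"
    using m assms by (intro mult_right_mono powr_mono2) auto
  finally show "real m powr (- \<omega>) \<le> real n powr (t - \<omega>) * real m powr (- t)" .
qed

text \<open>The distances near \<open>n\<close> give a harmonic sum, hence a logarithm. For \<omega>
  \<le> 1 the low indices give the same order; for larger \<open>\<omega>\<close> their sum
  converges, and its contribution \<open>real n powr (- \<gamma>)\<close> dominates.\<close>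

lemma sum_gap_model_le_\<sigma>_rate:
  fixes \<omega> \<gamma> :: real
  assumes \<gamma>: "\<gamma> > 0" "\<omega> + \<gamma> > 1"
  shows "\<exists>C>0. \<forall>n\<ge>1. \<forall>N. (\<Sum>m=1..N. real m powr (- \<omega>) / gap_model \<gamma> n m) \<le> C * \<sigma>_rate \<omega> \<gamma> n"
proof -
  define q where "q = 1 / (\<omega> + \<gamma> - 1)"
  have q: "q > 0"
    using \<gamma> by (simp add: q_def)
  show ?thesis
  proof (cases "\<omega> \<le> 1")
    case True
    define C where "C = 1 + 3 * 2 powr \<bar>\<omega>\<bar> + q"
    show ?thesis
    proof (intro exI[of _ C] conjI allI impI)
      show "C > 0"
        using q by (simp add: C_def add_pos_pos add_nonneg_pos)
      fix n N :: nat assume n: "n \<ge> 1"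
      define L where "L = ln (exp 1 * real n)"
      have L: "L \<ge> 1"
        unfolding L_def using n by (rule ln_exp_mult_ge_1)
      have harm: "(\<Sum>m=1..n. real m powr (- 1)) \<le> L"
        using sum_inverse_le_ln[OF n] by (simp add: L_def powr_minus divide_inverse)
      have first: "(\<Sum>m=1..n. real m powr (- \<omega>)) \<le> real n powr (1 - \<omega>) * L"
        by (rule order_trans[OF sum_powr_minus_le[OF True]]) (intro mult_left_mono harm, simp)
      have second: "(\<Sum>j=1..n. 1 / real j ^ 1) \<le> L"
        using sum_inverse_le_ln[OF n] by (simp add: L_def)
      have "(\<Sum>m=1..N. real m powr (- \<omega>) / gap_model \<gamma> n m)
          \<le> real n powr (- \<gamma>) * (real n powr (1 - \<omega>) * L)
            + 2 powr \<bar>\<omega>\<bar> * real n powr (1 - \<omega> - \<gamma>) * (1 + 2 * L) + real n powr (1 - \<omega> - \<gamma>) * q"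
        using sum_gap_model_le[OF \<gamma> n order_refl first second, of N] by (simp add: q_def)
      also have "real n powr (- \<gamma>) * (real n powr (1 - \<omega>) * L) = real n powr (1 - \<omega> - \<gamma>) * L"
        by (simp add: mult.assoc[symmetric] powr_add[symmetric])
      also have "2 powr \<bar>\<omega>\<bar> * real n powr (1 - \<omega> - \<gamma>) * (1 + 2 * L)
          \<le> 2 powr \<bar>\<omega>\<bar> * real n powr (1 - \<omega> - \<gamma>) * (3 * L)"
        using L by (intro mult_left_mono) auto
      also have "real n powr (1 - \<omega> - \<gamma>) * q \<le> real n powr (1 - \<omega> - \<gamma>) * (q * L)"
        using L q by (intro mult_left_mono) auto
      also have "real n powr (1 - \<omega> - \<gamma>) * L + 2 powr \<bar>\<omega>\<bar> * real n powr (1 - \<omega> - \<gamma>) * (3 * L)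
          + real n powr (1 - \<omega> - \<gamma>) * (q * L) = C * \<sigma>_rate \<omega> \<gamma> n"
        using True by (simp add: C_def \<sigma>_rate_def L_def algebra_simps)
      finally show "(\<Sum>m=1..N. real m powr (- \<omega>) / gap_model \<gamma> n m) \<le> C * \<sigma>_rate \<omega> \<gamma> n"
        by simp
    qed
  next
    case False
    \<comment> \<open>The near region is smaller than the target rate by exactly n^(-e) up to the
      logarithm, so a logarithm bounded by a multiple of n^e can be absorbed.\<close>
    define e where "e = \<omega> - 1"
    have e: "e > 0"
      using False by (simp add: e_def)
    define C where "C = (1 + 1 / e) + 2 powr \<bar>\<omega>\<bar> * (3 * (1 + 1 / e)) + q"
    show ?thesis
    proof (intro exI[of _ C] conjI allI impI)
      show "C > 0"
        using q e by (simp add: C_def add_pos_pos add_nonneg_pos)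
      fix n N :: nat assume n: "n \<ge> 1"
      define L where "L = ln (exp 1 * real n)"
      have L: "L \<ge> 1"
        unfolding L_def using n by (rule ln_exp_mult_ge_1)
      have L_le: "L \<le> (1 + 1 / e) * real n powr e"
        unfolding L_def using e n by (rule ln_exp_mult_le_powr)
      have first: "(\<Sum>m=1..n. real m powr (- \<omega>)) \<le> 1 + 1 / e"
        using sum_powr_le[of \<omega> n] False by (simp add: e_def)
      have second: "(\<Sum>j=1..n. 1 / real j ^ 1) \<le> L"
        using sum_inverse_le_ln[OF n] by (simp add: L_def)
      have "(\<Sum>m=1..N. real m powr (- \<omega>) / gap_model \<gamma> n m)
          \<le> real n powr (- \<gamma>) * (1 + 1 / e)
            + 2 powr \<bar>\<omega>\<bar> * real n powr (1 - \<omega> - \<gamma>) * (1 + 2 * L) + real n powr (1 - \<omega> - \<gamma>) * q"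
        using sum_gap_model_le[OF \<gamma> n order_refl first second, of N] by (simp add: q_def)
      also have "2 powr \<bar>\<omega>\<bar> * real n powr (1 - \<omega> - \<gamma>) * (1 + 2 * L)
          \<le> 2 powr \<bar>\<omega>\<bar> * real n powr (1 - \<omega> - \<gamma>) * (3 * ((1 + 1 / e) * real n powr e))"
        using L L_le by (intro mult_left_mono) auto
      also have "\<dots> = 2 powr \<bar>\<omega>\<bar> * (3 * (1 + 1 / e)) * (real n powr (1 - \<omega> - \<gamma>) * real n powr e)"
        by (simp only: mult_ac)
      also have "real n powr (1 - \<omega> - \<gamma>) * real n powr e = real n powr (- \<gamma>)"
        by (simp add: powr_add[symmetric] e_def)
      also have "real n powr (1 - \<omega> - \<gamma>) * q \<le> real n powr (- \<gamma>) * q"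
        using n q False by (intro mult_right_mono powr_mono) auto
      also have "real n powr (- \<gamma>) * (1 + 1 / e) + 2 powr \<bar>\<omega>\<bar> * (3 * (1 + 1 / e)) * real n powr (- \<gamma>)
          + real n powr (- \<gamma>) * q = C * \<sigma>_rate \<omega> \<gamma> n"
        using False by (simp add: C_def \<sigma>_rate_def algebra_simps)
      finally show "(\<Sum>m=1..N. real m powr (- \<omega>) / gap_model \<gamma> n m) \<le> C * \<sigma>_rate \<omega> \<gamma> n"
        by simp
    qed
  qed
qed

text \<open>With squared gaps the sum over distances converges, so no logarithm arises. The two
  regimes of the rate come from the low indices and, for \<omega> \<le> 2, also from the indices
  near \<open>n\<close>.\<close>

lemma sum_gap_model_power2_le_\<tau>_rate:
  fixes \<omega> \<gamma> :: real
  assumes \<gamma>: "\<gamma> > 0" "\<omega> + \<gamma> > 1"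
  shows "\<exists>C>0. \<forall>n\<ge>1. \<forall>N. (\<Sum>m=1..N. real m powr (- \<omega>) / (gap_model \<gamma> n m)\<^sup>2) \<le> C * \<tau>_rate \<omega> \<gamma> n"
proof -
  define q where "q = 1 / (\<omega> + \<gamma> - 1)"
  have q: "q > 0"
    using \<gamma> by (simp add: q_def)
  define C where "C = 2 + 5 * 2 powr \<bar>\<omega>\<bar> + q"
  \<comment> \<open>This merges both cases of the rate into the single power n^(t - 2
    \<gamma>).\<close>
  define t where "t = max 0 (2 - \<omega>)"
  show ?thesis
  proof (intro exI[of _ C] conjI allI impI)
    show "C > 0"
      using q by (simp add: C_def add_pos_pos add_nonneg_pos)
    fix n N :: nat assume n: "n \<ge> 1"
    have zeta2: "(\<Sum>m=1..n. real m powr (- 2)) \<le> 2"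
      using sum_powr_le[of 2 n] by simp
    have first: "(\<Sum>m=1..n. real m powr (- \<omega>)) \<le> real n powr t * 2"
    proof (cases "\<omega> \<le> 2")
      case True
      have "(\<Sum>m=1..n. real m powr (- \<omega>)) \<le> real n powr (2 - \<omega>) * 2"
        by (rule order_trans[OF sum_powr_minus_le[OF True]]) (intro mult_left_mono zeta2, simp)
      then show ?thesis
        using True by (simp add: t_def)
    next
      case False
      have "(\<Sum>m=1..n. real m powr (- \<omega>)) \<le> (\<Sum>m=1..n. real m powr (- 2))"
        using False by (intro sum_mono powr_mono) auto
      then show ?thesis
        using zeta2 False n by (simp add: t_def)
    qed
    have second: "(\<Sum>j=1..n. 1 / real j ^ 2) \<le> 2"
    proof -
      have "(\<Sum>j=1..n. 1 / real j ^ 2) = (\<Sum>m=1..n. real m powr (- 2))"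
        by (intro sum.cong) (auto simp: powr_minus divide_inverse powr_numeral)
      then show ?thesis
        using zeta2 by simp
    qed
    have \<tau>: "\<tau>_rate \<omega> \<gamma> n = real n powr (t - 2 * \<gamma>)"
      by (simp add: \<tau>_rate_def t_def algebra_simps)
    have "(\<Sum>m=1..N. real m powr (- \<omega>) / (gap_model \<gamma> n m)\<^sup>2)
        \<le> real n powr (- 2 * \<gamma>) * (real n powr t * 2)
          + 2 powr \<bar>\<omega>\<bar> * real n powr (2 - \<omega> - 2 * \<gamma>) * (1 + 2 * 2) + real n powr (1 - \<omega> - 2 * \<gamma>) * q"
      using sum_gap_model_le[OF \<gamma> n _ first second, of N] by (simp add: q_def)
    also have "real n powr (- 2 * \<gamma>) * (real n powr t * 2) = real n powr (t - 2 * \<gamma>) * 2"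
      by (simp add: mult.assoc[symmetric] powr_add[symmetric])
    also have "2 powr \<bar>\<omega>\<bar> * real n powr (2 - \<omega> - 2 * \<gamma>) * (1 + 2 * 2)
        \<le> 2 powr \<bar>\<omega>\<bar> * real n powr (t - 2 * \<gamma>) * (1 + 2 * 2)"
      using n by (intro mult_right_mono mult_left_mono powr_mono) (auto simp: t_def)
    also have "real n powr (1 - \<omega> - 2 * \<gamma>) * q \<le> real n powr (t - 2 * \<gamma>) * q"
      using n q by (intro mult_right_mono powr_mono) (auto simp: t_def)
    also have "real n powr (t - 2 * \<gamma>) * 2 + 2 powr \<bar>\<omega>\<bar> * real n powr (t - 2 * \<gamma>) * (1 + 2 * 2)
        + real n powr (t - 2 * \<gamma>) * q = C * \<tau>_rate \<omega> \<gamma> n"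
      by (simp add: C_def \<tau> algebra_simps)
    finally show "(\<Sum>m=1..N. real m powr (- \<omega>) / (gap_model \<gamma> n m)\<^sup>2) \<le> C * \<tau>_rate \<omega> \<gamma> n"
      by simp
  qed
qed

section \<open>Spectral gaps and integration over \<open>\<Gamma>\<^sub>n\<close>\<close>

lemma vector_derivative_affine:
  fixes g :: "real \<Rightarrow> complex"
  assumes "l < t" "t < u" "0 \<le> l" "u \<le> 1" "\<And>s. l < s \<Longrightarrow> s < u \<Longrightarrow> g s = x + s *\<^sub>R v"
  shows "vector_derivative g (at t within {0..1}) = v"
proof -
  have "((\<lambda>s. x + s *\<^sub>R v) has_vector_derivative v) (at t)"
    by (auto intro!: derivative_eq_intros)
  then have "(g has_vector_derivative v) (at t)"
    by (rule has_vector_derivative_transform_within_open[where S = "{l<..<u}"]) (use assms in auto)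
  then show ?thesis
    by (rule vector_derivative_at_within_ivl) (use assms in auto)
qed

text \<open>The nested concatenation runs through the four sides on [0, 1/2], [1/2, 3/4], [3/4, 7/8]
  and [7/8, 1], at 2, 4, 8 and 8 times the side length. The excluded parameters are the corners. In
  the cases below, \<open>x\<close> is the side's affine parametrisation extrapolated to time
  0.\<close>

lemma norm_vector_derivative_rectpath_le:
  assumes "t \<in> {0..1} - {0, 1/2, 3/4, 7/8, 1}"
  shows "norm (vector_derivative (rectpath p q) (at t within {0..1}))
    \<le> 8 * (\<bar>Re q - Re p\<bar> + \<bar>Im q - Im p\<bar>)"
proof -
  have bound: ?thesis if "vector_derivative (rectpath p q) (at t within {0..1}) = v"
    "norm v \<le> 8 * (\<bar>Re q - Re p\<bar> + \<bar>Im q - Im p\<bar>)" for v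
    using that by simp
  note defs = rectpath_def Let_def joinpaths_def linepath_def complex_eq_iff algebra_simps
  have norms: "norm (Complex x 0) = \<bar>x\<bar>" "norm (Complex 0 x) = \<bar>x\<bar>" for x
    by (simp_all add: cmod_def)
  consider "0 < t" "t < 1/2" | "1/2 < t" "t < 3/4" | "3/4 < t" "t < 7/8" | "7/8 < t" "t < 1"
    using assms by fastforce
  then show ?thesis
  proof cases
    case 1
    show ?thesis
    proof (rule bound)
      show "vector_derivative (rectpath p q) (at t within {0..1}) = Complex (2 * (Re q - Re p)) 0"
        by (rule vector_derivative_affine[OF 1, where x = p]) (auto simp: defs)
    qed (auto simp: norms abs_if)
  next
    case 2
    show ?thesis
    proof (rule bound)
      show "vector_derivative (rectpath p q) (at t within {0..1}) = Complex 0 (4 * (Im q - Im p))"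
        by (rule vector_derivative_affine[OF 2, where x = "Complex (Re q) (Im p - 2 * (Im q - Im p))"])
          (auto simp: defs)
    qed (auto simp: norms abs_if)
  next
    case 3
    show ?thesis
    proof (rule bound)
      show "vector_derivative (rectpath p q) (at t within {0..1}) = Complex (8 * (Re p - Re q)) 0"
        by (rule vector_derivative_affine[OF 3, where x = "Complex (Re q - 6 * (Re p - Re q)) (Im q)"])
          (auto simp: defs)
    qed (auto simp: norms abs_if)
  next
    case 4
    show ?thesis
    proof (rule bound)
      show "vector_derivative (rectpath p q) (at t within {0..1}) = Complex 0 (8 * (Im p - Im q))"
        by (rule vector_derivative_affine[OF 4, where x = "Complex (Re p) (Im q - 7 * (Im p - Im q))"])
          (auto simp: defs)
    qed (auto simp: norms abs_if)
  qed
qed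

text \<open>Pairing with \<open>y\<close> is bounded and linear, so it passes under the integral and
  the bound can be applied to one scalar coefficient at a time.\<close>

lemma norm_cinner_vector_contour_integral_rectpath_le:
  fixes f :: "complex \<Rightarrow> 'h::chilbert_space"
  assumes bound: "\<And>z. z \<in> path_image (rectpath p q) \<Longrightarrow> norm (cinner (f z) y) \<le> X"
  shows "norm (cinner (vector_contour_integral (rectpath p q) f) y)
    \<le> 8 * (\<bar>Re q - Re p\<bar> + \<bar>Im q - Im p\<bar>) * X"
proof -
  let ?g = "rectpath p q" and ?L = "8 * (\<bar>Re q - Re p\<bar> + \<bar>Im q - Im p\<bar>)"
  let ?h = "\<lambda>t. vector_derivative ?g (at t within {0..1}) *\<^sub>C f (?g t)"
  have "norm (cinner (f (?g 0)) y) \<le> X"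
    by (rule bound) (auto simp: path_image_def)
  then have X: "X \<ge> 0"
    by (rule order_trans[rotated]) simp
  show ?thesis
  proof (cases "?h integrable_on {0..1}")
    case True
    then have "(?h has_integral vector_contour_integral ?g f) {0..1}"
      unfolding vector_contour_integral_def by (rule integrable_integral)
    then have "((\<lambda>t. cinner (?h t) y) has_integral cinner (vector_contour_integral ?g f) y) (cbox 0 1)"
      using has_integral_linear[OF _ bounded_linear_cinner_left] unfolding o_def box_real by blast
    then have "norm (cinner (vector_contour_integral ?g f) y) \<le> ?L * X * measure lborel (cbox 0 (1::real))"
    proof (rule has_integral_bound_spike_finite[rotated 2])
      show "0 \<le> ?L * X"
        using X by simp
      show "finite {0, 1/2, 3/4, 7/8, 1::real}"
        by simp
      fix t :: real assume t: "t \<in> cbox 0 1 - {0, 1/2, 3/4, 7/8, 1}"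
      have "norm (cinner (?h t) y) = norm (vector_derivative ?g (at t within {0..1})) * norm (cinner (f (?g t)) y)"
        by (simp add: cinner_scaleC_left norm_mult)
      also have "\<dots> \<le> ?L * X"
        using t by (intro mult_mono norm_vector_derivative_rectpath_le bound) (auto simp: path_image_def)
      finally show "norm (cinner (?h t) y) \<le> ?L * X" .
    qed
    then show ?thesis
      by simp
  next
    \<comment> \<open>The integral then has its default value 0, and \<open>X\<close> is nonnegative
      because the path image is nonempty.\<close>
    case False
    then have "vector_contour_integral ?g f = 0"
      unfolding vector_contour_integral_def by (rule not_integrable_integral)
    then show ?thesis
      using X by simp
  qed
qed

lemma gap_model_ge:
  assumes "\<gamma> > 0" "n \<ge> 1"
  shows "real n powr (\<gamma> - 1) \<le> gap_model \<gamma> n m"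
proof -
  have "real n powr (\<gamma> - 1) \<le> real n powr \<gamma>"
    using assms by (intro powr_mono) auto
  moreover have "real n powr \<gamma> \<le> real m powr \<gamma>" if "2 * n \<le> m"
    using assms that by (intro powr_mono2) auto
  moreover have "real n powr (\<gamma> - 1) * 1 \<le> real n powr (\<gamma> - 1) * max 1 \<bar>real n - real m\<bar>"
    by (intro mult_left_mono) auto
  ultimately show ?thesis
    unfolding gap_model_def by (auto intro: order_trans)
qed

section \<open>Eigenvalue distances from the gap condition\<close>

locale spectral_gap =
  fixes \<mu> :: "nat \<Rightarrow> real" and \<kappa> \<gamma> :: real and N\<^sub>0 :: nat
  assumes \<mu>_1_pos: "\<mu> 1 > 0"
    and \<mu>_mono: "\<And>k. k \<ge> 1 \<Longrightarrow> \<mu> k \<le> \<mu> (k + 1)"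
    and \<gamma>_pos: "\<gamma> > 0" and \<kappa>_pos: "\<kappa> > 0" and N\<^sub>0_pos: "N\<^sub>0 > 0"
    and gap: "\<And>k. k \<ge> N\<^sub>0 \<Longrightarrow> \<mu> (k + 1) - \<mu> k \<ge> \<kappa> * real k powr (\<gamma> - 1)"
begin

text \<open>The gap constant after replacing the power of \<open>k\<close> by that of
  \<open>n\<close>, for \<open>k\<close> within a factor 2 of \<open>n\<close>.\<close>

definition c\<^sub>0 :: real where
  "c\<^sub>0 = \<kappa> * 2 powr (- \<bar>\<gamma> - 1\<bar>)"

text \<open>From here on, all indices from n/2 upwards, and also \<open>n - 1\<close>, satisfy the
  gap condition, and \<open>n - 1\<close> is at least n/2.\<close>

definition N\<^sub>1 :: nat where
  "N\<^sub>1 = 2 * N\<^sub>0 + 2"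

text \<open>Up to a constant, a lower bound for the distance of \<open>\<mu> m\<close> from the
  contour around \<open>\<mu> n\<close>. On the diagonal the vanishing difference is replaced by the
  scale of the rectangle.\<close>

definition eigen_dist :: "nat \<Rightarrow> nat \<Rightarrow> real" where
  "eigen_dist n m = (if m = n then real n powr (\<gamma> - 1) else \<bar>\<mu> m - \<mu> n\<bar>)"

lemma c\<^sub>0_pos: "c\<^sub>0 > 0"
  using \<kappa>_pos by (simp add: c\<^sub>0_def)

lemma \<mu>_le:
  assumes "1 \<le> i" "i \<le> j"
  shows "\<mu> i \<le> \<mu> j"
  using assms(2)
proof (induction j rule: dec_induct)
  case (step j)
  then show ?case
    using \<mu>_mono[of j] assms(1) by simp
qed simp

lemma \<mu>_gt_0: "k \<ge> 1 \<Longrightarrow> \<mu> k > 0"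
  using \<mu>_le[of 1 k] \<mu>_1_pos by simp

lemma \<mu>_diff_ge:
  assumes "i \<le> j" "N\<^sub>0 \<le> i" "\<And>k. i \<le> k \<Longrightarrow> k < j \<Longrightarrow> c \<le> \<kappa> * real k powr (\<gamma> - 1)"
  shows "c * (real j - real i) \<le> \<mu> j - \<mu> i"
  using assms(1,3)
proof (induction j rule: dec_induct)
  case (step j)
  have "c * (real j - real i) \<le> \<mu> j - \<mu> i"
    using step by auto
  moreover have "c \<le> \<mu> (j + 1) - \<mu> j"
    using step.prems[of j] step.hyps gap[of j] assms(2) by simp
  ultimately show ?case
    by (simp add: algebra_simps)
qed simp

lemma \<mu>_diff_near_ge:
  assumes "i \<le> j" "N\<^sub>0 \<le> i" "n \<ge> 1" "n \<le> 2 * i" "j \<le> 2 * n"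
  shows "c\<^sub>0 * real n powr (\<gamma> - 1) * (real j - real i) \<le> \<mu> j - \<mu> i"
proof (rule \<mu>_diff_ge[OF assms(1,2)])
  fix k assume k: "i \<le> k" "k < j"
  have "2 powr (- \<bar>\<gamma> - 1\<bar>) * real n powr (\<gamma> - 1) \<le> real k powr (\<gamma> - 1)"
    using k assms by (intro powr_comparable) auto
  then show "c\<^sub>0 * real n powr (\<gamma> - 1) \<le> \<kappa> * real k powr (\<gamma> - 1)"
    using \<kappa>_pos by (simp add: c\<^sub>0_def)
qed

lemma \<mu>_diff_far_ge:
  assumes "1 \<le> m" "2 * m \<le> n" "2 * N\<^sub>0 \<le> n"
  shows "c\<^sub>0 / 4 * real n powr \<gamma> \<le> \<mu> n - \<mu> m"
proof -
  \<comment> \<open>Monotonicity handles the indices below \<open>h\<close>, where the gap condition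
    may fail. For \<open>n\<close> at least 2 there remain n - h \<ge> n/4 gaps above
    \<open>h\<close>, hence the constant \<open>c\<^sub>0 / 4\<close>.\<close>
  define h where "h = (n + 1) div 2"
  have h: "h \<le> n" "N\<^sub>0 \<le> h" "n \<le> 2 * h" "m \<le> h" "2 * h \<le> n + 1" and n: "n \<ge> 2"
    using assms by (auto simp: h_def)
  have "c\<^sub>0 / 4 * real n powr \<gamma> = c\<^sub>0 * real n powr (\<gamma> - 1) * (real n / 4)"
    using n by (simp add: powr_diff)
  also have "\<dots> \<le> c\<^sub>0 * real n powr (\<gamma> - 1) * (real n - real h)"
    using h n c\<^sub>0_pos by (intro mult_left_mono) auto
  also have "\<dots> \<le> \<mu> n - \<mu> h"
    using h n by (intro \<mu>_diff_near_ge) auto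
  also have "\<dots> \<le> \<mu> n - \<mu> m"
    using \<mu>_le[of m h] h assms by simp
  finally show ?thesis .
qed

lemma \<mu>_ge: "n \<ge> N\<^sub>1 \<Longrightarrow> c\<^sub>0 / 4 * real n powr \<gamma> \<le> \<mu> n"
  using \<mu>_diff_far_ge[of 1 n] \<mu>_1_pos by (simp add: N\<^sub>1_def)

lemma eigen_dist_ge:
  assumes "n \<ge> N\<^sub>1" "m \<ge> 1"
  shows "min 1 (c\<^sub>0 / 4) * gap_model \<gamma> n m \<le> eigen_dist n m"
proof -
  let ?c = "min 1 (c\<^sub>0 / 4)"
  have n: "n \<ge> 2 * N\<^sub>0 + 2"
    using assms by (simp add: N\<^sub>1_def)
  have c: "?c \<le> c\<^sub>0 / 4" "?c \<le> c\<^sub>0"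
    using c\<^sub>0_pos by auto
  consider "2 * m \<le> n" | "m = n" | "n < 2 * m" "m < 2 * n" "m \<noteq> n" | "2 * n \<le> m"
    by linarith
  then show ?thesis
  proof cases
    case 1
    have "?c * real n powr \<gamma> \<le> c\<^sub>0 / 4 * real n powr \<gamma>"
      using c by (intro mult_right_mono) auto
    also have "\<dots> \<le> \<mu> n - \<mu> m"
      using 1 n assms by (intro \<mu>_diff_far_ge) auto
    finally show ?thesis
      using 1 n by (auto simp: gap_model_def eigen_dist_def)
  next
    case 2
    have "?c * real n powr (\<gamma> - 1) \<le> 1 * real n powr (\<gamma> - 1)"
      by (intro mult_right_mono) auto
    then show ?thesis
      using 2 n by (simp add: gap_model_def eigen_dist_def)
  next
    case 3
    have "?c * (real n powr (\<gamma> - 1) * \<bar>real n - real m\<bar>) \<le> c\<^sub>0 * (real n powr (\<gamma> - 1) * \<bar>real n - real m\<bar>)"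
      using c by (intro mult_right_mono) auto
    also have "\<dots> \<le> \<bar>\<mu> m - \<mu> n\<bar>"
      using \<mu>_diff_near_ge[of n m n] \<mu>_diff_near_ge[of m n n] 3 n
      by (cases "m \<le> n") (auto simp: mult.assoc)
    finally show ?thesis
      using 3 by (auto simp: gap_model_def eigen_dist_def max_def)
  next
    case 4
    have "?c * real m powr \<gamma> \<le> c\<^sub>0 / 4 * real m powr \<gamma>"
      using c by (intro mult_right_mono) auto
    also have "\<dots> \<le> \<mu> m - \<mu> n"
      \<comment> \<open>Here \<open>m\<close> is the larger index, so the roles of \<open>m\<close>
        and \<open>n\<close> are exchanged.\<close>
      using 4 n by (intro \<mu>_diff_far_ge) auto
    finally show ?thesis
      using 4 n by (auto simp: gap_model_def eigen_dist_def)
  qed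
qed

text \<open>For \<open>m = n\<close> the distance is at least the smaller of the offsets
  \<open>d\<close> and \<open>e\<close> of the sides. Otherwise each vertical side reaches at most
  halfway to the neighbouring eigenvalue, so at least half of the distance between
  \<open>\<mu> m\<close> and \<open>\<mu> n\<close> survives.\<close>

lemma \<Gamma>_path_dist_ge:
  assumes "n \<ge> N\<^sub>1" "m \<ge> 1" "z \<in> path_image (\<Gamma>_path \<mu> \<kappa> \<gamma> n)"
  shows "min (1 / 2) (c\<^sub>0 / 2) * eigen_dist n m \<le> norm (z - of_real (\<mu> m))"
proof -
  let ?c = "min (1 / 2) (c\<^sub>0 / 2)"
  define d where "d = \<kappa> / 2 * (real n - 1) powr (\<gamma> - 1)"
  define e where "e = \<kappa> / 2 * real n powr (\<gamma> - 1)"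
  have n: "n \<ge> 2 * N\<^sub>0 + 2"
    using assms by (simp add: N\<^sub>1_def)
  have de: "0 \<le> d" "0 \<le> e"
    using \<kappa>_pos by (auto simp: d_def e_def)
  have z: "Re z \<in> {\<mu> n - d, \<mu> n + e} \<and> Im z \<in> {- e..e} \<or> Im z \<in> {- e, e} \<and> Re z \<in> {\<mu> n - d..\<mu> n + e}"
    using assms(3) de
    unfolding \<Gamma>_path_def d_def[symmetric] e_def[symmetric] by (subst (asm) path_image_rectpath) auto
  have Re_bound: "\<bar>Re z - \<mu> m\<bar> \<le> norm (z - of_real (\<mu> m))" for m
    using abs_Re_le_cmod[of "z - of_real (\<mu> m)"] by simp
  have Im_bound: "\<bar>Im z\<bar> \<le> norm (z - of_real (\<mu> m))" for m
    using abs_Im_le_cmod[of "z - of_real (\<mu> m)"] by simp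
  consider "m = n" | "n < m" | "m < n"
    by linarith
  then show ?thesis
  proof cases
    case 1
    have "2 powr (- \<bar>\<gamma> - 1\<bar>) * real n powr (\<gamma> - 1) \<le> (real n - 1) powr (\<gamma> - 1)"
      using n by (intro powr_comparable) auto
    then have d: "c\<^sub>0 / 2 * real n powr (\<gamma> - 1) \<le> d"
      using \<kappa>_pos by (simp add: c\<^sub>0_def d_def)
    have "2 powr (- \<bar>\<gamma> - 1\<bar>) * real n powr (\<gamma> - 1) \<le> real n powr (\<gamma> - 1)"
      using n by (intro powr_comparable) auto
    then have e: "c\<^sub>0 / 2 * real n powr (\<gamma> - 1) \<le> e"
      using \<kappa>_pos by (simp add: c\<^sub>0_def e_def)
    have "?c * real n powr (\<gamma> - 1) \<le> c\<^sub>0 / 2 * real n powr (\<gamma> - 1)"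
      by (intro mult_right_mono) auto
    also have "\<dots> \<le> min d e"
      using d e by simp
    also have "\<dots> \<le> norm (z - of_real (\<mu> n))"
      using z Re_bound[of n] Im_bound[of n] de by (auto simp: min_def)
    finally show ?thesis
      using 1 by (simp add: eigen_dist_def)
  next
    case 2
    have "2 * e \<le> \<mu> (n + 1) - \<mu> n"
      using gap[of n] n by (simp add: e_def)
    moreover have "\<mu> (n + 1) \<le> \<mu> m"
      using 2 by (intro \<mu>_le) auto
    ultimately have "\<mu> m - \<mu> n \<le> 2 * (\<mu> m - Re z)" "0 \<le> \<mu> m - \<mu> n"
      using z de by auto
    moreover have "?c * \<bar>\<mu> m - \<mu> n\<bar> \<le> 1 / 2 * \<bar>\<mu> m - \<mu> n\<bar>"
      by (intro mult_right_mono) auto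
    ultimately show ?thesis
      using 2 Re_bound[of m] by (auto simp: eigen_dist_def)
  next
    case 3
    have "2 * d \<le> \<mu> n - \<mu> (n - 1)"
      using gap[of "n - 1"] n by (simp add: d_def of_nat_diff)
    moreover have "\<mu> m \<le> \<mu> (n - 1)"
      using 3 assms by (intro \<mu>_le) auto
    ultimately have "\<mu> n - \<mu> m \<le> 2 * (Re z - \<mu> m)" "0 \<le> \<mu> n - \<mu> m"
      using z de by auto
    moreover have "?c * \<bar>\<mu> m - \<mu> n\<bar> \<le> 1 / 2 * \<bar>\<mu> m - \<mu> n\<bar>"
      by (intro mult_right_mono) auto
    ultimately show ?thesis
      using 3 Re_bound[of m] by (auto simp: eigen_dist_def)
  qed
qed

lemma norm_cinner_contour_integral_\<Gamma>_path_le: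
  fixes f :: "complex \<Rightarrow> 'h::chilbert_space"
  assumes n: "n \<ge> N\<^sub>1"
    and bound: "\<And>z. z \<in> path_image (\<Gamma>_path \<mu> \<kappa> \<gamma> n) \<Longrightarrow> norm (cinner (f z) y) \<le> X"
  shows "norm (cinner (vector_contour_integral (\<Gamma>_path \<mu> \<kappa> \<gamma> n) f) y)
    \<le> 4 * \<kappa> * (2 powr \<bar>\<gamma> - 1\<bar> + 3) * real n powr (\<gamma> - 1) * X"
proof -
  let ?L = "4 * \<kappa> * ((real n - 1) powr (\<gamma> - 1) + 3 * real n powr (\<gamma> - 1))"
  have "norm (cinner (f (\<Gamma>_path \<mu> \<kappa> \<gamma> n 0)) y) \<le> X"
    by (rule bound) (auto simp: path_image_def)
  then have X: "X \<ge> 0"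
    by (rule order_trans[rotated]) simp
  have "norm (cinner (vector_contour_integral (\<Gamma>_path \<mu> \<kappa> \<gamma> n) f) y) \<le> ?L * X"
    unfolding \<Gamma>_path_def
    by (rule order_trans[OF norm_cinner_vector_contour_integral_rectpath_le[OF bound[unfolded \<Gamma>_path_def]]])
      (use \<kappa>_pos in \<open>auto simp: algebra_simps\<close>)
  also have "(real n - 1) powr (\<gamma> - 1) \<le> 2 powr \<bar>\<gamma> - 1\<bar> * real n powr (\<gamma> - 1)"
    using n by (intro powr_comparable) (auto simp: N\<^sub>1_def)
  then have "?L * X \<le> 4 * \<kappa> * (2 powr \<bar>\<gamma> - 1\<bar> * real n powr (\<gamma> - 1) + 3 * real n powr (\<gamma> - 1)) * X"
    using \<kappa>_pos X by (intro mult_right_mono mult_left_mono add_right_mono) auto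
  finally show ?thesis
    by (simp add: algebra_simps)
qed

end

section \<open>Bounds on \<open>\<phi>\<^sub>n\<^bsup>(k)\<^esup>\<close>\<close>

locale gapped_form = form_setting \<psi> V a b S \<mu> \<alpha> M + spectral_gap \<mu> \<kappa> \<gamma> N\<^sub>0
  for \<psi> :: "nat \<Rightarrow> 'h::chilbert_space" and V :: "'h set" and a b :: "'h \<Rightarrow> 'h \<Rightarrow> complex"
    and S :: "'h \<Rightarrow> 'h" and \<mu> :: "nat \<Rightarrow> real" and \<alpha> M \<kappa> \<gamma> :: real and N\<^sub>0 :: nat +
  assumes exponents: "2 * \<alpha> + \<gamma> > 1"
begin

lemma norm_cinner_\<phi>_vec_le:
  "\<exists>C\<ge>0. \<forall>n\<ge>N\<^sub>1. \<forall>m\<ge>1. norm (cinner (\<phi>_vec \<mu> \<psi> b \<kappa> \<gamma> (Suc k) n) (\<psi> m))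
     \<le> C * \<sigma>_rate (2 * \<alpha>) \<gamma> n ^ k * real n powr (- \<alpha>) * real m powr (- \<alpha>) / eigen_dist n m"
proof -
  define c where "c = min (1 / 2) (c\<^sub>0 / 2)"
  define d where "d = min 1 (c\<^sub>0 / 4)"
  have cd: "c > 0" "d > 0"
    using c\<^sub>0_pos by (auto simp: c_def d_def)
  obtain C\<^sub>1 where C\<^sub>1: "C\<^sub>1 > 0"
    "\<And>n N. n \<ge> 1 \<Longrightarrow> (\<Sum>m=1..N. real m powr (- (2 * \<alpha>)) / gap_model \<gamma> n m) \<le> C\<^sub>1 * \<sigma>_rate (2 * \<alpha>) \<gamma> n"
    using sum_gap_model_le_\<sigma>_rate[OF \<gamma>_pos exponents] by blast
  define L where "L = 4 * \<kappa> * (2 powr \<bar>\<gamma> - 1\<bar> + 3)"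
  define C where "C = L * M ^ Suc k * (C\<^sub>1 / (c * d)) ^ k / c\<^sup>2"
  show ?thesis
  proof (intro exI[of _ C] conjI allI impI)
    show "C \<ge> 0"
      using M_nonneg C\<^sub>1(1) cd \<kappa>_pos by (simp add: C_def L_def)
    fix n m :: nat
    assume n: "n \<ge> N\<^sub>1" and m: "m \<ge> 1"
    have n1: "n \<ge> 1"
      using n by (simp add: N\<^sub>1_def)
    define P where "P = C\<^sub>1 / (c * d) * \<sigma>_rate (2 * \<alpha>) \<gamma> n"
    define X where "X = M ^ Suc k * P ^ k * real m powr (- \<alpha>) * real n powr (- \<alpha>)
      / ((c * eigen_dist n m) * (c * real n powr (\<gamma> - 1)))"
    define f where "f = (\<lambda>z. K_op \<mu> \<psi> z ((B_op \<mu> \<psi> b z ^^ Suc k) (K_op \<mu> \<psi> z (\<psi> n))))"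
    have "norm (cinner (f z) (\<psi> m)) \<le> X" if z: "z \<in> path_image (\<Gamma>_path \<mu> \<kappa> \<gamma> n)" for z
    proof -
      have dist: "c * eigen_dist n j \<le> norm (z - of_real (\<mu> j))" if "j \<ge> 1" for j
        using \<Gamma>_path_dist_ge[OF n that z] by (simp add: c_def)
      have dist': "c * d * gap_model \<gamma> n j \<le> norm (z - of_real (\<mu> j))" if "j \<ge> 1" for j
      proof -
        have "c * (d * gap_model \<gamma> n j) \<le> c * eigen_dist n j"
          using eigen_dist_ge[OF n that] cd by (intro mult_left_mono) (auto simp: d_def)
        then show ?thesis
          using dist[OF that] by (simp add: mult.assoc)
      qed
      \<comment> \<open>Both parameters depend on \<open>n\<close> but not on \<open>z\<close>, so
        the coefficient bound is uniform along the contour.\<close>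
      interpret resolvent_point \<psi> V a b S \<mu> \<alpha> M z "c * d * real n powr (\<gamma> - 1)" P
      proof unfold_locales
        show "0 < c * d * real n powr (\<gamma> - 1)"
          using cd n1 by simp
        show "c * d * real n powr (\<gamma> - 1) \<le> norm (z - of_real (\<mu> j))" if "j \<ge> 1" for j
        proof -
          have "c * d * real n powr (\<gamma> - 1) \<le> c * d * gap_model \<gamma> n j"
            using cd gap_model_ge[OF \<gamma>_pos n1, of j] by (intro mult_left_mono) auto
          then show ?thesis
            using dist'[OF that] by simp
        qed
        show "(\<Sum>j=1..N. real j powr (- 2 * \<alpha>) / norm (z - of_real (\<mu> j))) \<le> P" for N
        proof -
          have "(\<Sum>j=1..N. real j powr (- 2 * \<alpha>) / norm (z - of_real (\<mu> j)))
              \<le> (\<Sum>j=1..N. real j powr (- (2 * \<alpha>)) / (c * d * gap_model \<gamma> n j))"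
            using gap_model_pos[OF n1] cd
            by (intro sum_mono frac_le) (auto intro: dist')
          also have "\<dots> = (\<Sum>j=1..N. real j powr (- (2 * \<alpha>)) / gap_model \<gamma> n j) / (c * d)"
            by (simp add: sum_divide_distrib field_simps)
          also have "\<dots> \<le> C\<^sub>1 * \<sigma>_rate (2 * \<alpha>) \<gamma> n / (c * d)"
            using cd by (intro divide_right_mono C\<^sub>1(2) n1) auto
          finally show ?thesis
            by (simp add: P_def)
        qed
      qed
      have "norm (cinner (f z) (\<psi> m)) \<le> M ^ Suc k * P ^ k * real m powr (- \<alpha>) * real n powr (- \<alpha>)
        / (norm (z - of_real (\<mu> m)) * norm (z - of_real (\<mu> n)))"
        unfolding f_def by (rule integrand_bound[OF m n1])
      also have "\<dots> \<le> X"
        unfolding X_def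
      proof (rule frac_le)
        have pos: "eigen_dist n j > 0" if "j \<ge> 1" for j
          using eigen_dist_ge[OF n that] gap_model_pos[OF n1 that, of \<gamma>] cd
          by (metis d_def mult_pos_pos order_less_le_trans)
        then show "0 < c * eigen_dist n m * (c * real n powr (\<gamma> - 1))"
          using cd m n1 by simp
        show "c * eigen_dist n m * (c * real n powr (\<gamma> - 1)) \<le> norm (z - of_real (\<mu> m)) * norm (z - of_real (\<mu> n))"
          using dist[OF n1] cd n1 by (intro mult_mono dist m) (auto simp: eigen_dist_def)
        show "0 \<le> M ^ Suc k * P ^ k * real m powr (- \<alpha>) * real n powr (- \<alpha>)"
          using M_nonneg P_nonneg by simp
      qed simp
      finally show ?thesis .
    qed
    then have "norm (cinner (vector_contour_integral (\<Gamma>_path \<mu> \<kappa> \<gamma> n) f) (\<psi> m))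
        \<le> L * real n powr (\<gamma> - 1) * X"
      unfolding L_def by (rule norm_cinner_contour_integral_\<Gamma>_path_le[OF n])
    \<comment> \<open>The factor \<open>real n powr (\<gamma> - 1)\<close> from the length of the
      contour cancels the reciprocal distance to \<open>\<mu> n\<close>.\<close>
    also have "\<dots> = C * \<sigma>_rate (2 * \<alpha>) \<gamma> n ^ k * real n powr (- \<alpha>) * real m powr (- \<alpha>) / eigen_dist n m"
      using cd n1 by (simp add: X_def P_def C_def power_mult_distrib power_divide power2_eq_square mult_ac)
    finally have le: "norm (cinner (vector_contour_integral (\<Gamma>_path \<mu> \<kappa> \<gamma> n) f) (\<psi> m))
      \<le> C * \<sigma>_rate (2 * \<alpha>) \<gamma> n ^ k * real n powr (- \<alpha>) * real m powr (- \<alpha>) / eigen_dist n m" .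
    have "norm (cinner (\<phi>_vec \<mu> \<psi> b \<kappa> \<gamma> (Suc k) n) (\<psi> m))
        = 1 / (2 * pi) * norm (cinner (vector_contour_integral (\<Gamma>_path \<mu> \<kappa> \<gamma> n) f) (\<psi> m))"
      by (simp add: \<phi>_vec_def f_def cinner_scaleC_left norm_mult norm_divide)
    also have "\<dots> \<le> 1 * norm (cinner (vector_contour_integral (\<Gamma>_path \<mu> \<kappa> \<gamma> n) f) (\<psi> m))"
      using pi_gt3 by (intro mult_right_mono) auto
    finally show "norm (cinner (\<phi>_vec \<mu> \<psi> b \<kappa> \<gamma> (Suc k) n) (\<psi> m))
      \<le> C * \<sigma>_rate (2 * \<alpha>) \<gamma> n ^ k * real n powr (- \<alpha>) * real m powr (- \<alpha>) / eigen_dist n m"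
      using le by simp
  qed
qed

text \<open>One estimate serves all orders: the power \<open>Suc k\<close> of \<open>B\<close>
  leaves \<open>k\<close> factors of the rate in each coefficient, hence \<open>2 * k\<close> after
  squaring.\<close>

lemma norm_\<phi>_vec_le:
  "\<exists>C\<ge>0. \<forall>n\<ge>N\<^sub>1. (norm ((\<mu> n powr (- 1/2)) *\<^sub>R S (\<phi>_vec \<mu> \<psi> b \<kappa> \<gamma> (Suc k) n)))\<^sup>2
     \<le> C * (\<sigma>_rate (2 * \<alpha>) \<gamma> n ^ (2 * k) *
         (real n powr (- (2 * \<alpha> + \<gamma>)) * \<sigma>_rate (2 * \<alpha>) \<gamma> n + real n powr (- 2 * \<alpha>) * \<tau>_rate (2 * \<alpha>) \<gamma> n))"
proof -
  define d where "d = min 1 (c\<^sub>0 / 4)"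
  have d: "d > 0"
    using c\<^sub>0_pos by (simp add: d_def)
  obtain C\<^sub>1 where C\<^sub>1: "C\<^sub>1 > 0"
    "\<And>n N. n \<ge> 1 \<Longrightarrow> (\<Sum>m=1..N. real m powr (- (2 * \<alpha>)) / gap_model \<gamma> n m) \<le> C\<^sub>1 * \<sigma>_rate (2 * \<alpha>) \<gamma> n"
    using sum_gap_model_le_\<sigma>_rate[OF \<gamma>_pos exponents] by blast
  obtain C\<^sub>2 where C\<^sub>2: "C\<^sub>2 > 0"
    "\<And>n N. n \<ge> 1 \<Longrightarrow> (\<Sum>m=1..N. real m powr (- (2 * \<alpha>)) / (gap_model \<gamma> n m)\<^sup>2) \<le> C\<^sub>2 * \<tau>_rate (2 * \<alpha>) \<gamma> n"
    using sum_gap_model_power2_le_\<tau>_rate[OF \<gamma>_pos exponents] by blast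
  obtain C\<^sub>3 where C\<^sub>3: "C\<^sub>3 \<ge> 0"
    "\<And>n m. n \<ge> N\<^sub>1 \<Longrightarrow> m \<ge> 1 \<Longrightarrow> norm (cinner (\<phi>_vec \<mu> \<psi> b \<kappa> \<gamma> (Suc k) n) (\<psi> m))
     \<le> C\<^sub>3 * \<sigma>_rate (2 * \<alpha>) \<gamma> n ^ k * real n powr (- \<alpha>) * real m powr (- \<alpha>) / eigen_dist n m"
    using norm_cinner_\<phi>_vec_le[of k] by blast
  \<comment> \<open>The second entry comes from the lower bound \<open>\<mu>_ge\<close> for
    \<open>\<mu> n\<close>, used when dividing the first-power sum by
    \<open>\<mu> n\<close>.\<close>
  define E where "E = max (C\<^sub>2 / d\<^sup>2) (4 * C\<^sub>1 / (d * c\<^sub>0))"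
  show ?thesis
  proof (intro exI[of _ "C\<^sub>3\<^sup>2 * E"] conjI allI impI)
    show "C\<^sub>3\<^sup>2 * E \<ge> 0"
      using C\<^sub>2(1) d by (simp add: E_def le_max_iff_disj)
    fix n :: nat assume n: "n \<ge> N\<^sub>1"
    have n1: "n \<ge> 1"
      using n by (simp add: N\<^sub>1_def)
    define \<phi> where "\<phi> = \<phi>_vec \<mu> \<psi> b \<kappa> \<gamma> (Suc k) n"
    define \<sigma> where "\<sigma> = \<sigma>_rate (2 * \<alpha>) \<gamma> n"
    define \<tau> where "\<tau> = \<tau>_rate (2 * \<alpha>) \<gamma> n"
    define Y where "Y = C\<^sub>3\<^sup>2 * \<sigma> ^ (2 * k) * real n powr (- 2 * \<alpha>)"
    have \<sigma>: "\<sigma> \<ge> 0"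
      using n1 by (simp add: \<sigma>_def \<sigma>_rate_nonneg)
    have \<tau>: "\<tau> \<ge> 0"
      by (simp add: \<tau>_def \<tau>_rate_nonneg)
    have Y: "Y \<ge> 0"
      using \<sigma> by (simp add: Y_def)
    have \<mu>n: "\<mu> n > 0"
      using \<mu>_pos n1 by simp
    have entry: "\<mu> m * (norm (cinner \<phi> (\<psi> m)))\<^sup>2
        \<le> Y * (\<mu> n / d\<^sup>2 * (real m powr (- (2 * \<alpha>)) / (gap_model \<gamma> n m)\<^sup>2)
          + 1 / d * (real m powr (- (2 * \<alpha>)) / gap_model \<gamma> n m))" if m: "m \<ge> 1" for m
    proof -
      let ?D = "eigen_dist n m" and ?G = "d * gap_model \<gamma> n m"
      have G: "?G > 0" "?G \<le> ?D"
        using gap_model_pos[OF n1 m] eigen_dist_ge[OF n m] d by (auto simp: d_def)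
      have \<mu>m: "\<mu> m \<ge> 0"
        using \<mu>_pos[OF m] by simp
      \<comment> \<open>This splits the weight \<open>\<mu> m\<close>: the part
        \<open>\<mu> n\<close> meets the squared reciprocal distance, while \<open>?D\<close>
        cancels one of the two factors.\<close>
      have D: "\<mu> m \<le> \<mu> n + ?D"
        by (auto simp: eigen_dist_def)
      have "(norm (cinner \<phi> (\<psi> m)))\<^sup>2
          \<le> (C\<^sub>3 * \<sigma> ^ k * real n powr (- \<alpha>) * real m powr (- \<alpha>) / ?D)\<^sup>2"
        unfolding \<phi>_def \<sigma>_def by (intro power_mono C\<^sub>3(2) n m) simp
      also have "\<dots> = Y * real m powr (- (2 * \<alpha>)) / ?D\<^sup>2"
        using n1 m by (simp add: Y_def power_mult_distrib power_divide powr_power power_even_eq)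
      finally have "\<mu> m * (norm (cinner \<phi> (\<psi> m)))\<^sup>2 \<le> \<mu> m * (Y * real m powr (- (2 * \<alpha>)) / ?D\<^sup>2)"
        using \<mu>m by (rule mult_left_mono)
      also have "\<dots> \<le> (\<mu> n + ?D) * (Y * real m powr (- (2 * \<alpha>)) / ?D\<^sup>2)"
        using D Y by (intro mult_right_mono) auto
      also have "\<dots> = Y * real m powr (- (2 * \<alpha>)) * (\<mu> n / ?D\<^sup>2 + 1 / ?D)"
        using G by (simp add: field_simps power2_eq_square)
      also have "\<dots> \<le> Y * real m powr (- (2 * \<alpha>)) * (\<mu> n / ?G\<^sup>2 + 1 / ?G)"
        using G \<mu>n Y by (intro mult_left_mono add_mono frac_le power_mono) auto
      finally show ?thesis
        by (simp add: power_mult_distrib algebra_simps)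
    qed
    have "(\<Sum>m=1..N. \<mu> m * (norm (cinner \<phi> (\<psi> m)))\<^sup>2)
        \<le> Y * (\<mu> n / d\<^sup>2 * (C\<^sub>2 * \<tau>) + 1 / d * (C\<^sub>1 * \<sigma>))" for N
    proof -
      have "(\<Sum>m=1..N. \<mu> m * (norm (cinner \<phi> (\<psi> m)))\<^sup>2)
          \<le> (\<Sum>m=1..N. Y * (\<mu> n / d\<^sup>2 * (real m powr (- (2 * \<alpha>)) / (gap_model \<gamma> n m)\<^sup>2)
            + 1 / d * (real m powr (- (2 * \<alpha>)) / gap_model \<gamma> n m)))"
        by (intro sum_mono entry) simp
      also have "\<dots> = Y * (\<mu> n / d\<^sup>2 * (\<Sum>m=1..N. real m powr (- (2 * \<alpha>)) / (gap_model \<gamma> n m)\<^sup>2)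
            + 1 / d * (\<Sum>m=1..N. real m powr (- (2 * \<alpha>)) / gap_model \<gamma> n m))"
        by (simp only: sum_distrib_left[symmetric] sum.distrib)
      also have "\<dots> \<le> Y * (\<mu> n / d\<^sup>2 * (C\<^sub>2 * \<tau>) + 1 / d * (C\<^sub>1 * \<sigma>))"
        unfolding \<sigma>_def \<tau>_def using Y \<mu>n d
        by (intro mult_left_mono add_mono C\<^sub>1(2) C\<^sub>2(2) n1) auto
      finally show ?thesis .
    qed
    \<comment> \<open>The uniform bound on the partial sums also places \<open>\<phi>\<close> in the
      form domain, so \<open>S \<phi>\<close> is meaningful.\<close>
    then have S_le: "(norm (S \<phi>))\<^sup>2 \<le> Y * (\<mu> n / d\<^sup>2 * (C\<^sub>2 * \<tau>) + 1 / d * (C\<^sub>1 * \<sigma>))"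
      by (rule norm_S_le)
    have "(\<mu> n powr (- 1/2))\<^sup>2 = \<mu> n powr (- 1)"
      by (simp add: power2_eq_square powr_add[symmetric])
    then have "(\<mu> n powr (- 1/2))\<^sup>2 = 1 / \<mu> n"
      using \<mu>n powr_neg_one by simp
    then have "(norm ((\<mu> n powr (- 1/2)) *\<^sub>R S \<phi>))\<^sup>2 = (norm (S \<phi>))\<^sup>2 / \<mu> n"
      by (simp add: power_mult_distrib)
    also have "\<dots> \<le> Y * (\<mu> n / d\<^sup>2 * (C\<^sub>2 * \<tau>) + 1 / d * (C\<^sub>1 * \<sigma>)) / \<mu> n"
      using \<mu>n by (intro divide_right_mono S_le) simp
    also have "\<dots> = Y * (C\<^sub>2 / d\<^sup>2 * \<tau> + C\<^sub>1 / d * \<sigma> * (1 / \<mu> n))"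
      using \<mu>n d by (simp add: field_simps)
    also have "\<dots> \<le> Y * (C\<^sub>2 / d\<^sup>2 * \<tau> + C\<^sub>1 / d * \<sigma> * (1 / (c\<^sub>0 / 4 * real n powr \<gamma>)))"
      using Y \<sigma> d C\<^sub>1(1) \<mu>_ge[OF n] c\<^sub>0_pos n1
      by (intro mult_left_mono add_left_mono divide_left_mono mult_pos_pos \<mu>n) auto
    also have "\<dots> = Y * (C\<^sub>2 / d\<^sup>2 * \<tau> + 4 * C\<^sub>1 / (d * c\<^sub>0) * (\<sigma> * real n powr (- \<gamma>)))"
      by (simp add: powr_minus field_simps)
    also have "\<dots> \<le> Y * (E * \<tau> + E * (\<sigma> * real n powr (- \<gamma>)))"
      using Y \<sigma> \<tau> by (intro mult_left_mono add_mono mult_right_mono) (auto simp: E_def)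
    also have "\<dots> = C\<^sub>3\<^sup>2 * E * (\<sigma> ^ (2 * k) *
         ((real n powr (- 2 * \<alpha>) * real n powr (- \<gamma>)) * \<sigma> + real n powr (- 2 * \<alpha>) * \<tau>))"
      by (simp add: Y_def algebra_simps)
    also have "real n powr (- 2 * \<alpha>) * real n powr (- \<gamma>) = real n powr (- (2 * \<alpha> + \<gamma>))"
      by (simp add: powr_add[symmetric])
    finally show "(norm ((\<mu> n powr (- 1/2)) *\<^sub>R S (\<phi>_vec \<mu> \<psi> b \<kappa> \<gamma> (Suc k) n)))\<^sup>2
      \<le> C\<^sub>3\<^sup>2 * E * (\<sigma>_rate (2 * \<alpha>) \<gamma> n ^ (2 * k) *
         (real n powr (- (2 * \<alpha> + \<gamma>)) * \<sigma>_rate (2 * \<alpha>) \<gamma> n + real n powr (- 2 * \<alpha>) * \<tau>_rate (2 * \<alpha>) \<gamma> n))"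
      unfolding \<phi>_def \<sigma>_def \<tau>_def .
  qed
qed

end

text \<open>The vector v = S u - sqrt(l) u satisfies S v = - sqrt(l) v, and nonnegativity of
  \<open>S\<close> forces v = 0.\<close>

lemma nonneg_square_root_eigenvector:
  assumes sqrt: "nonneg_square_root D A V S" and "u \<in> D" "A u = l *\<^sub>R u" "l > 0"
  shows "S u = sqrt l *\<^sub>R u"
proof -
  have "densely_defined_operator V S"
    using sqrt unfolding nonneg_square_root_def self_adjoint_def by blast
  then have V: "csubspace V" and add: "\<And>x y. x \<in> V \<Longrightarrow> y \<in> V \<Longrightarrow> S (x + y) = S x + S y"
    and scale: "\<And>c x. x \<in> V \<Longrightarrow> S (c *\<^sub>C x) = c *\<^sub>C S x"
    unfolding densely_defined_operator_def by blast+
  have u: "u \<in> V" "S u \<in> V" "S (S u) = l *\<^sub>R u"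
    using sqrt assms(2,3) unfolding nonneg_square_root_def by auto
  let ?c = "complex_of_real (- sqrt l)"
  define v where "v = S u + ?c *\<^sub>C u"
  have cu: "?c *\<^sub>C u \<in> V"
    using V u unfolding csubspace_def by blast
  then have v: "v \<in> V"
    using V u unfolding csubspace_def v_def by blast
  have "S v = l *\<^sub>R u + ?c *\<^sub>C S u"
    unfolding v_def by (simp only: add[OF u(2) cu] scale[OF u(1)] u(3))
  also have "\<dots> = - sqrt l *\<^sub>R v"
    using \<open>l > 0\<close> unfolding v_def scaleC_complex_of_real by (simp add: scaleR_right_diff_distrib algebra_simps)
  finally have "S v = (- sqrt l) *\<^sub>R v" .
  then have "Re (cinner (S v) v) = - sqrt l * (norm v)\<^sup>2"
    by (simp only: cinner_scaleR_left cinner_self Re_complex_of_real of_real_mult[symmetric])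
  moreover have "Re (cinner (S v) v) \<ge> 0"
    using sqrt v unfolding nonneg_square_root_def by blast
  ultimately have "sqrt l * (norm v)\<^sup>2 \<le> 0"
    by simp
  then have "v = 0"
    using \<open>l > 0\<close> by (simp add: mult_le_0_iff)
  then show ?thesis
    unfolding v_def scaleC_complex_of_real by simp
qed

text \<open>Cutting \<open>h\<close> off at \<open>C * F n\<close> leaves a remainder of at most
  \<open>C * G n\<close>. This turns a bound by a sum into a sum of two separate O-terms.\<close>

lemma bounded_sum_split:
  fixes h F G :: "nat \<Rightarrow> real"
  assumes "C \<ge> 0" and bound: "\<And>n. n \<ge> n0 \<Longrightarrow> 0 \<le> F n \<and> 0 \<le> G n \<and> 0 \<le> h n \<and> h n \<le> C * (F n + G n)"
  shows "\<exists>f g. f \<in> O(F) \<and> g \<in> O(G) \<and> (\<forall>\<^sub>F n in sequentially. h n = f n + g n)"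
proof (intro exI conjI)
  show "(\<lambda>n. min (h n) (C * F n)) \<in> O(F)"
    using assms by (intro bigoI[where c = C] eventually_sequentiallyI[of n0]) (auto simp: min_def)
  show "(\<lambda>n. h n - min (h n) (C * F n)) \<in> O(G)"
    using assms by (intro bigoI[where c = C] eventually_sequentiallyI[of n0])
      (auto simp: min_def algebra_simps)
qed simp

theorem lemmaA7:
  fixes V D :: "'h::chilbert_space set"
    and a b :: "'h \<Rightarrow> 'h \<Rightarrow> complex"
    and A Ahalf :: "'h \<Rightarrow> 'h"
    and \<mu> :: "nat \<Rightarrow> real" and \<psi> :: "nat \<Rightarrow> 'h"
    and \<alpha> \<gamma> \<kappa> M\<^sub>b :: real and N\<^sub>0 :: nat
  assumes H_separable: "separable_space (euclidean :: 'h topology)"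
    and H_infinite_dim: "infinite_dimensional TYPE('h)"
    and a_form: "sesquilinear_on V a" "closure V = UNIV" "closed_form V a"
      "hermitian_on V a" "positive_definite_on V a"
    and A_self_adjoint: "self_adjoint D A"
    and Ahalf_sqrt: "nonneg_square_root D A V Ahalf"
    and A_associated: "\<And>u v. u \<in> V \<Longrightarrow> v \<in> V \<Longrightarrow> a u v = cinner (Ahalf u) (Ahalf v)"
    and A_compact_resolvent: "compact_resolvent D A"
    and \<psi>_basis: "orthonormal_basis {1..} \<psi>"
    and \<psi>_eigen: "\<And>k. k \<ge> 1 \<Longrightarrow> \<psi> k \<in> D \<and> A (\<psi> k) = \<mu> k *\<^sub>R \<psi> k"
    and \<mu>_pos: "\<mu> 1 > 0"
    and \<mu>_mono: "\<And>k. k \<ge> 1 \<Longrightarrow> \<mu> k \<le> \<mu> (k + 1)"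
    and b_form: "sesquilinear_on V b" "form_continuous_on V a b"
    and gap_consts: "\<gamma> > 0" "\<kappa> > 0" "N\<^sub>0 > 0"
    and gap: "\<And>k. k \<ge> N\<^sub>0 \<Longrightarrow> \<mu> (k + 1) - \<mu> k \<ge> \<kappa> * real k powr (\<gamma> - 1)"
    and exponents: "2 * \<alpha> + \<gamma> > 1"
    and M\<^sub>b_pos: "M\<^sub>b > 0"
    and b_bound: "\<And>m n. m \<ge> 1 \<Longrightarrow> n \<ge> 1 \<Longrightarrow>
      norm (b (\<psi> m) (\<psi> n)) \<le> M\<^sub>b * real m powr (- \<alpha>) * real n powr (- \<alpha>)"
  shows "(\<exists>f g. f \<in> O(\<lambda>n. real n powr (- (2 * \<alpha> + \<gamma>)) * \<sigma>_rate (2 * \<alpha>) \<gamma> n) \<and>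
            g \<in> O(\<lambda>n. real n powr (- 2 * \<alpha>) * \<tau>_rate (2 * \<alpha>) \<gamma> n) \<and>
            (\<forall>\<^sub>F n in sequentially.
               (norm ((\<mu> n powr (- 1/2)) *\<^sub>R Ahalf (\<phi>_vec \<mu> \<psi> b \<kappa> \<gamma> 1 n)))\<^sup>2 = f n + g n))
       \<and> (\<forall>k\<ge>2.
            (\<lambda>n. (norm ((\<mu> n powr (- 1/2)) *\<^sub>R Ahalf (\<phi>_vec \<mu> \<psi> b \<kappa> \<gamma> k n)))\<^sup>2)
            \<in> O(\<lambda>n. \<sigma>_rate (2 * \<alpha>) \<gamma> n ^ (2 * (k - 1)) *
                   (real n powr (- (2 * \<alpha> + \<gamma>)) * \<sigma>_rate (2 * \<alpha>) \<gamma> n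
                    + real n powr (- 2 * \<alpha>) * \<tau>_rate (2 * \<alpha>) \<gamma> n)))"
proof -
  have dense: "densely_defined_operator V Ahalf"
    using Ahalf_sqrt unfolding nonneg_square_root_def self_adjoint_def by blast
  interpret spectral_gap \<mu> \<kappa> \<gamma> N\<^sub>0
    by unfold_locales (use \<mu>_pos \<mu>_mono gap_consts gap in auto)
  interpret gapped_form \<psi> V a b Ahalf \<mu> \<alpha> M\<^sub>b \<kappa> \<gamma> N\<^sub>0
  proof unfold_locales
    show "Ahalf (\<psi> k) = sqrt (\<mu> k) *\<^sub>R \<psi> k" if "k \<ge> 1" for k
      using nonneg_square_root_eigenvector[OF Ahalf_sqrt] \<psi>_eigen[OF that] \<mu>_gt_0[OF that] by blast
    show "\<psi> k \<in> V" if "k \<ge> 1" for k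
      using \<psi>_eigen[OF that] Ahalf_sqrt unfolding nonneg_square_root_def by blast
  qed (use assms dense \<mu>_gt_0 in \<open>auto simp: densely_defined_operator_def sesquilinear_on_def\<close>)
  let ?F = "\<lambda>n. real n powr (- (2 * \<alpha> + \<gamma>)) * \<sigma>_rate (2 * \<alpha>) \<gamma> n"
  let ?G = "\<lambda>n. real n powr (- 2 * \<alpha>) * \<tau>_rate (2 * \<alpha>) \<gamma> n"
  let ?h = "\<lambda>k n. (norm ((\<mu> n powr (- 1/2)) *\<^sub>R Ahalf (\<phi>_vec \<mu> \<psi> b \<kappa> \<gamma> k n)))\<^sup>2"
  have FG: "0 \<le> ?F n" "0 \<le> ?G n" if "n \<ge> N\<^sub>1" for n
    using that by (auto simp: N\<^sub>1_def intro!: mult_nonneg_nonneg \<sigma>_rate_nonneg \<tau>_rate_nonneg)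
  show ?thesis
  proof (intro conjI allI impI)
    \<comment> \<open>For the first order the rate occurs to the power 0, so only the two terms to
      be separated remain.\<close>
    obtain C where C: "C \<ge> 0" "\<And>n. n \<ge> N\<^sub>1 \<Longrightarrow> ?h 1 n \<le> C * (?F n + ?G n)"
      using norm_\<phi>_vec_le[of 0] by auto
    then show "\<exists>f g. f \<in> O(?F) \<and> g \<in> O(?G) \<and> (\<forall>\<^sub>F n in sequentially. ?h 1 n = f n + g n)"
      using FG by (intro bounded_sum_split[of C N\<^sub>1]) auto
  next
    fix k :: nat assume "k \<ge> 2"
    then obtain j where k: "k = Suc j"
      by (cases k) auto
    obtain C where C: "\<And>n. n \<ge> N\<^sub>1 \<Longrightarrow> ?h k n \<le> C * (\<sigma>_rate (2 * \<alpha>) \<gamma> n ^ (2 * (k - 1)) * (?F n + ?G n))"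
      using norm_\<phi>_vec_le[of j] unfolding k by auto
    show "?h k \<in> O(\<lambda>n. \<sigma>_rate (2 * \<alpha>) \<gamma> n ^ (2 * (k - 1)) * (?F n + ?G n))"
    proof (intro bigoI[where c = C] eventually_sequentiallyI[of N\<^sub>1])
      fix n assume n: "n \<ge> N\<^sub>1"
      have "0 \<le> \<sigma>_rate (2 * \<alpha>) \<gamma> n ^ (2 * (k - 1)) * (?F n + ?G n)"
        by (rule mult_nonneg_nonneg[OF _ add_nonneg_nonneg[OF FG[OF n]]]) (simp add: power_mult)
      then show "norm (?h k n) \<le> C * norm (\<sigma>_rate (2 * \<alpha>) \<gamma> n ^ (2 * (k - 1)) * (?F n + ?G n))"
        using C[OF n] by (simp only: real_norm_def abs_of_nonneg abs_power2)
    qed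
  qed
qed

end
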